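(* Let $\lambda>0$ be a real number. If there exists a periodic tiling of the plane by squares with periods $(1,0)$ and $(0,\lambda)$, then $\lambda = p \pm \sqrt{q^2-r^2}$ for some rational numbers $p \ge q \ge r \ge 0$.
   Context: Let $G=\{(m,n\lambda): m,n\in\mathbb{Z}\}$. Two points of the plane are called simply equivalent if one is obtained from the other by a translation by a vector of $G$. A periodic tiling of the plane by squares with periods $(1,0)$ and $(0,\lambda)$ is a finite set $\Gamma_1$ of squares in the plane with pairwise disjoint interiors such that (1) every point of the plane is simply equivalent to some point of the union of the squares of $\Gamma_1$, and (2) no two distinct points of the interior of the union of the squares of $\Gamma_1$ are simply equivalent. *)

theory Defs
  imports "HOL-Analysis.Analysis"
begin

definition period_lattice :: "real \<Rightarrow> (real \<times> real) set" where
  "period_lattice lam = {(of_int m, of_int n * lam) | m n :: int. True}"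

definition simply_equivalent :: "real \<Rightarrow> real \<times> real \<Rightarrow> real \<times> real \<Rightarrow> bool" where
  "simply_equivalent lam x y \<longleftrightarrow> (\<exists>g \<in> period_lattice lam. y = x + g)"

text \<open>Squares are closed, of positive side, and in arbitrary position: the sides need not be
  parallel to the coordinate axes.\<close>

definition is_square :: "(real \<times> real) set \<Rightarrow> bool" where
  "is_square S \<longleftrightarrow> (\<exists>a u v. u \<noteq> 0 \<and> norm u = norm v \<and> u \<bullet> v = 0 \<and>
     S = {a + s *\<^sub>R u + t *\<^sub>R v | s t. s \<in> {0..1} \<and> t \<in> {0..1}})"

definition periodic_square_tiling :: "real \<Rightarrow> (real \<times> real) set set \<Rightarrow> bool" where
  "periodic_square_tiling lam \<Gamma> \<longleftrightarrow>
     finite \<Gamma> \<and>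
     (\<forall>S \<in> \<Gamma>. is_square S) \<and>
     pairwise (\<lambda>S T. interior S \<inter> interior T = {}) \<Gamma> \<and>
     (\<forall>x. \<exists>y \<in> \<Union>\<Gamma>. simply_equivalent lam x y) \<and>
     (\<forall>x \<in> interior (\<Union>\<Gamma>). \<forall>y \<in> interior (\<Union>\<Gamma>). x \<noteq> y \<longrightarrow> \<not> simply_equivalent lam x y)"

end

theory Submission
  imports Defs
begin

text \<open>
  Two squares with disjoint interiors that share two points are parallel, since a separating line
  through both points contains a side of each. So the union of the translates of the squares
  parallel to a given one and the union of all other translates are closed sets that cover the plane
  and have a countable intersection. The plane minus a countable set is connected, hence all squares
  are parallel.

  In coordinates along the sides, the lattice is spanned by \<open>(c, -s)\<close> and \<open>\<lambda> (s, c)\<close> with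
  \<open>c\<^sup>2 + s\<^sup>2 = 1\<close>, and the rectangles \<open>c \<times> \<lambda> c\<close> and \<open>\<lambda> s \<times> s\<close> together form another fundamental
  domain. For additive \<open>f, g : \<real> \<rightarrow> \<real>\<close> the area \<open>f(width) g(height)\<close> is additive under dissection
  and invariant under translation. Squares of sides \<open>h\<^sub>i\<close> therefore satisfy
  \<open>\<Sum> f(h\<^sub>i) g(h\<^sub>i) = f(c) g(\<lambda> c) + f(\<lambda> s) g(s)\<close>. For irrational \<open>\<lambda>\<close>, the symmetry in \<open>f, g\<close> forces
  \<open>s\<close> and \<open>\<lambda> s\<close> into the rational span of \<open>c\<close> and \<open>\<lambda> c\<close>, so \<open>\<lambda>\<close> is quadratic, and nonnegativity for
  \<open>f = g\<close> makes its conjugate positive.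
\<close>

section \<open>Squares with a normalised direction\<close>

text \<open>Up to quarter turns a square has exactly one side direction \<open>(c, s)\<close> with \<open>c > 0\<close> and
  \<open>s \<ge> 0\<close>, so parallel squares are those with equal \<open>c\<close> and \<open>s\<close>.\<close>

definition box_square :: "real \<Rightarrow> real \<Rightarrow> real \<Rightarrow> real \<Rightarrow> real \<Rightarrow> (real \<times> real) set" where
  "box_square c s a b h = {z. a \<le> c * fst z + s * snd z \<and> c * fst z + s * snd z \<le> a + h \<and>
     b \<le> c * snd z - s * fst z \<and> c * snd z - s * fst z \<le> b + h}"

lemma box_square_quarter_turn: "box_square c s a b h = box_square (- s) c b (- a - h) h"
  by (auto simp: box_square_def algebra_simps)

text \<open>An orthogonal vector of equal length is a quarter turn in one of two senses; exchanging
  \<open>u\<close> and \<open>v\<close> reduces one sense to the other. Further quarter turns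
  normalise the direction.\<close>

lemma is_square_imp_box_square:
  assumes "is_square S"
  obtains c s a b h where "c > 0" "s \<ge> 0" "c\<^sup>2 + s\<^sup>2 = 1" "h > 0" "S = box_square c s a b h"
proof -
  obtain p u v where uv: "u \<noteq> 0" "norm u = norm v" "u \<bullet> v = 0"
    and S: "S = {p + x *\<^sub>R u + y *\<^sub>R v | x y. x \<in> {0..1} \<and> y \<in> {0..1}}"
    using assms unfolding is_square_def by blast
  obtain p1 p2 u1 u2 v1 v2 where pr: "p = (p1, p2)" "u = (u1, u2)" "v = (v1, v2)"
    by (cases p, cases u, cases v) auto
  define h where "h = norm u"
  have h: "h > 0" using uv(1) by (simp add: h_def)
  have hu: "u1\<^sup>2 + u2\<^sup>2 = h\<^sup>2" by (simp add: h_def pr norm_Pair)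
  have hv: "v1\<^sup>2 + v2\<^sup>2 = h\<^sup>2" unfolding h_def uv(2) by (simp add: pr norm_Pair)
  have orth: "u1 * v1 + u2 * v2 = 0" using uv(3) by (simp add: pr)
  have key: "\<exists>c s a b. c\<^sup>2 + s\<^sup>2 = 1 \<and> S = box_square c s a b h"
    if w: "w1\<^sup>2 + w2\<^sup>2 = h\<^sup>2"
      and SW: "S = {p + x *\<^sub>R (w1,w2) + y *\<^sub>R (- w2, w1) | x y. x \<in> {0..1} \<and> y \<in> {0..1}}" for w1 w2
  proof -
    define c s where "c = w1 / h" and "s = w2 / h"
    have w12: "w1 = h * c" "w2 = h * s" using h by (auto simp: c_def s_def)
    have cs: "c\<^sup>2 + s\<^sup>2 = 1" using w h by (simp add: c_def s_def field_simps)
    define a b where "a = c * p1 + s * p2" and "b = c * p2 - s * p1"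
    have "S = box_square c s a b h"
    proof (intro set_eqI iffI)
      fix z assume "z \<in> S"
      then obtain x y where z: "z = (p1 + x * w1 - y * w2, p2 + x * w2 + y * w1)"
        and xy: "0 \<le> x" "x \<le> 1" "0 \<le> y" "y \<le> 1"
        unfolding SW pr by auto
      have "c * fst z + s * snd z = a + (c\<^sup>2 + s\<^sup>2) * (h * x)"
        by (simp add: z w12 a_def power2_eq_square algebra_simps)
      moreover have "c * snd z - s * fst z = b + (c\<^sup>2 + s\<^sup>2) * (h * y)"
        by (simp add: z w12 b_def power2_eq_square algebra_simps)
      ultimately show "z \<in> box_square c s a b h"
        unfolding box_square_def using cs xy h by simp
    next
      fix z assume z: "z \<in> box_square c s a b h"
      define x y where "x = (c * fst z + s * snd z - a) / h" and "y = (c * snd z - s * fst z - b) / h"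
      have xy: "x \<in> {0..1}" "y \<in> {0..1}" using z h by (auto simp: x_def y_def box_square_def)
      have hx: "x * h = c * fst z + s * snd z - a" "y * h = c * snd z - s * fst z - b"
        using h by (auto simp: x_def y_def)
      have "p1 + x * w1 - y * w2 = p1 + c * (x * h) - s * (y * h)" by (simp add: w12)
      also have "\<dots> = p1 + (c\<^sup>2 + s\<^sup>2) * (fst z - p1)"
        unfolding hx by (simp add: a_def b_def power2_eq_square algebra_simps)
      finally have 1: "fst z = p1 + x * w1 - y * w2" using cs by simp
      have "p2 + x * w2 + y * w1 = p2 + s * (x * h) + c * (y * h)" by (simp add: w12)
      also have "\<dots> = p2 + (c\<^sup>2 + s\<^sup>2) * (snd z - p2)"
        unfolding hx by (simp add: a_def b_def power2_eq_square algebra_simps)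
      finally have 2: "snd z = p2 + x * w2 + y * w1" using cs by simp
      have "z = p + x *\<^sub>R (w1,w2) + y *\<^sub>R (- w2, w1)" using 1 2 by (simp add: pr prod_eq_iff)
      then show "z \<in> S" unfolding SW using xy by blast
    qed
    then show ?thesis using cs by blast
  qed
  have "v = (- u2, u1) \<or> u = (- v2, v1)"
  proof -
    \<comment> \<open>Orthogonality makes \<open>v\<close> equal to \<open>k\<close> times the
      quarter turn \<open>(- u2, u1)\<close> of \<open>u\<close>; equal norms force \<open>k\<close>
      to be 1 or -1.\<close>
    define k where "k = (u1 * v2 - u2 * v1) / h\<^sup>2"
    have hk: "h\<^sup>2 * k = u1 * v2 - u2 * v1" using h by (simp add: k_def)
    have v: "v1 = - k * u2" "v2 = k * u1"
    proof -
      have "h\<^sup>2 * v1 = u1 * (u1 * v1 + u2 * v2) - u2 * (u1 * v2 - u2 * v1)"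
        unfolding hu[symmetric] by (simp add: power2_eq_square algebra_simps)
      also have "\<dots> = h\<^sup>2 * (- k * u2)" unfolding orth hk[symmetric] by simp
      finally show "v1 = - k * u2" using h by (simp only: mult_cancel_left) simp
      have "h\<^sup>2 * v2 = u2 * (u1 * v1 + u2 * v2) + u1 * (u1 * v2 - u2 * v1)"
        unfolding hu[symmetric] by (simp add: power2_eq_square algebra_simps)
      also have "\<dots> = h\<^sup>2 * (k * u1)" unfolding orth hk[symmetric] by simp
      finally show "v2 = k * u1" using h by (simp only: mult_cancel_left) simp
    qed
    have "k\<^sup>2 * h\<^sup>2 = 1 * h\<^sup>2" using hv unfolding v hu[symmetric] by (simp add: power2_eq_square algebra_simps)
    then have "k\<^sup>2 = 1" using h by simp
    then have "k = 1 \<or> k = -1" by (simp add: power2_eq_1_iff)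
    then show ?thesis unfolding pr v by auto
  qed
  then have "\<exists>c s a b. c\<^sup>2 + s\<^sup>2 = 1 \<and> S = box_square c s a b h"
  proof
    assume "v = (- u2, u1)"
    then show ?thesis using key[OF hu] S pr by simp
  next
    assume u: "u = (- v2, v1)"
    have "S = {p + x *\<^sub>R v + y *\<^sub>R u | x y. x \<in> {0..1} \<and> y \<in> {0..1}}"
      unfolding S by (auto simp: algebra_simps) (metis add.commute)+
    then show ?thesis using key[OF hv] u pr by simp
  qed
  then obtain c s a b where cs: "c\<^sup>2 + s\<^sup>2 = 1" and SB: "S = box_square c s a b h" by blast
  have "\<exists>c s a b. c > 0 \<and> s \<ge> 0 \<and> c\<^sup>2 + s\<^sup>2 = 1 \<and> S = box_square c s a b h"
  proof -
    have e1: "S = box_square (- s) c b (- a - h) h" unfolding SB by (rule box_square_quarter_turn)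
    have e2: "S = box_square (- c) (- s) (- a - h) (- b - h) h"
      unfolding e1 by (rule box_square_quarter_turn)
    have e3: "S = box_square s (- c) (- b - h) a h"
      unfolding e2 by (subst box_square_quarter_turn) simp
    have cs': "s\<^sup>2 + c\<^sup>2 = 1" using cs by simp
    \<comment> \<open>These half-open quadrants cover all unit vectors and are permuted by quarter
      turns.\<close>
    consider "c > 0" "s \<ge> 0" | "s < 0" "c \<ge> 0" | "c < 0" "s \<le> 0" | "s > 0" "c \<le> 0"
      using cs by fastforce
    then show ?thesis
    proof cases
      case 1 then show ?thesis using cs SB by blast
    next
      case 2
      have "- s > 0 \<and> c \<ge> 0 \<and> (- s)\<^sup>2 + (c)\<^sup>2 = 1 \<and> S = box_square (- s) (c) (b) (- a - h) h"
        by (intro conjI e1) (use 2 cs' in auto)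
      then show ?thesis by blast
    next
      case 3
      have "- c > 0 \<and> - s \<ge> 0 \<and> (- c)\<^sup>2 + (- s)\<^sup>2 = 1 \<and> S = box_square (- c) (- s) (- a - h) (- b - h) h"
        by (intro conjI e2) (use 3 cs in auto)
      then show ?thesis by blast
    next
      case 4
      have "s > 0 \<and> - c \<ge> 0 \<and> (s)\<^sup>2 + (- c)\<^sup>2 = 1 \<and> S = box_square (s) (- c) (- b - h) (a) h"
        by (intro conjI e3) (use 4 cs' in auto)
      then show ?thesis by blast
    qed
  qed
  then show ?thesis using that h by blast
qed

section \<open>Rotated coordinates and topology of squares\<close>

lemma interior_box_square_superset:
  "{z. a < c * fst z + s * snd z \<and> c * fst z + s * snd z < a + h \<and>
     b < c * snd z - s * fst z \<and> c * snd z - s * fst z < b + h} \<subseteq> interior (box_square c s a b h)"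
  by (rule interior_maximal)
    (auto simp: box_square_def intro!: open_Collect_conj open_Collect_less continuous_intros)

text \<open>The inverse rotation writes down a point whose coordinates along the sides are
  prescribed.\<close>

lemma rotated_coordinates:
  fixes c s X Y :: real
  assumes "c\<^sup>2 + s\<^sup>2 = 1"
  shows "c * (c * X - s * Y) + s * (s * X + c * Y) = X"
    and "c * (s * X + c * Y) - s * (c * X - s * Y) = Y"
proof -
  have "c * (c * X - s * Y) + s * (s * X + c * Y) = (c\<^sup>2 + s\<^sup>2) * X"
    "c * (s * X + c * Y) - s * (c * X - s * Y) = (c\<^sup>2 + s\<^sup>2) * Y"
    by (simp_all add: power2_eq_square algebra_simps)
  then show "c * (c * X - s * Y) + s * (s * X + c * Y) = X"
    and "c * (s * X + c * Y) - s * (c * X - s * Y) = Y" using assms by simp_all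
qed

lemma interior_box_square_nonempty:
  assumes "c\<^sup>2 + s\<^sup>2 = 1" "h > 0"
  shows "interior (box_square c s a b h) \<noteq> {}"
proof -
  define X Y where "X = a + h / 2" and "Y = b + h / 2"
  have "(c * X - s * Y, s * X + c * Y) \<in> interior (box_square c s a b h)"
    using assms by (intro subsetD[OF interior_box_square_superset])
      (simp add: rotated_coordinates, simp add: X_def Y_def)
  then show ?thesis by blast
qed

lemma convex_box_square: "convex (box_square c s a b h)"
proof -
  have "box_square c s a b h = {z. (c, s) \<bullet> z \<ge> a} \<inter> {z. (c, s) \<bullet> z \<le> a + h} \<inter>
     {z. (- s, c) \<bullet> z \<ge> b} \<inter> {z. (- s, c) \<bullet> z \<le> b + h}"
    by (auto simp: box_square_def inner_prod_def)
  then show ?thesis by (simp add: convex_Int convex_halfspace_le convex_halfspace_ge)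
qed

lemma closed_box_square: "closed (box_square c s a b h)"
  unfolding box_square_def
  by (intro closed_Collect_conj closed_Collect_le continuous_intros)

lemma bounded_box_square:
  assumes "c\<^sup>2 + s\<^sup>2 = 1"
  shows "bounded (box_square c s a b h)"
proof -
  have "norm z \<le> \<bar>a\<bar> + \<bar>h\<bar> + (\<bar>b\<bar> + \<bar>h\<bar>)" if "z \<in> box_square c s a b h" for z
  proof -
    let ?X = "c * fst z + s * snd z" and ?Y = "c * snd z - s * fst z"
    have "?X\<^sup>2 + ?Y\<^sup>2 = (c\<^sup>2 + s\<^sup>2) * ((fst z)\<^sup>2 + (snd z)\<^sup>2)"
      by (simp add: power2_eq_square algebra_simps)
    then have "norm z = norm (?X, ?Y)" using assms by (simp add: norm_prod_def)
    also have "\<dots> \<le> \<bar>?X\<bar> + \<bar>?Y\<bar>" by (metis norm_Pair_le real_norm_def)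
    also have "\<dots> \<le> \<bar>a\<bar> + \<bar>h\<bar> + (\<bar>b\<bar> + \<bar>h\<bar>)"
      using that by (auto simp: box_square_def)
    finally show ?thesis .
  qed
  then show ?thesis unfolding bounded_iff by blast
qed

section \<open>Supporting lines and parallel squares\<close>

lemma box_square_linear_max_unique:
  assumes "\<And>X Y. a \<le> X \<Longrightarrow> X \<le> a + h \<Longrightarrow> b \<le> Y \<Longrightarrow> Y \<le> b + h \<Longrightarrow> \<alpha> * X + \<beta> * Y \<le> (k::real)"
    and "\<alpha> * X1 + \<beta> * Y1 = k" "\<alpha> * X2 + \<beta> * Y2 = k"
    and "a \<le> X1" "X1 \<le> a + h" "b \<le> Y1" "Y1 \<le> b + h"
    and "a \<le> X2" "X2 \<le> a + h" "b \<le> Y2" "Y2 \<le> b + h"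
    and "(X1, Y1) \<noteq> (X2, Y2)"
  shows "\<alpha> = 0 \<or> \<beta> = 0"
proof (rule ccontr)
  assume "\<not> ?thesis"
  then have n: "\<alpha> \<noteq> 0" "\<beta> \<noteq> 0" by auto
  \<comment> \<open>Exchanging the second coordinates of the two maximisers stays in the box. The
    two new values are at most \<open>k\<close> and add up to \<open>2 * k\<close>, so both equal
    \<open>k\<close>.\<close>
  have "\<alpha> * X1 + \<beta> * Y2 \<le> k" "\<alpha> * X2 + \<beta> * Y1 \<le> k" using assms by blast+
  then have 1: "\<alpha> * X1 + \<beta> * Y2 = k" using assms(2,3) by linarith
  then have "\<beta> * (Y1 - Y2) = 0" "\<alpha> * (X1 - X2) = 0"
    using assms(2,3) unfolding right_diff_distrib by linarith+
  then show False using n assms(12) by simp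
qed

text \<open>In rotated coordinates the functional has coefficients \<alpha> and \<beta>, and one of
  them vanishes because the maximum is attained twice. Geometrically, the supporting line is
  parallel to a side.\<close>

lemma box_square_supporting_line:
  assumes cs: "c\<^sup>2 + s\<^sup>2 = 1"
    and le: "\<And>z. z \<in> box_square c s a b h \<Longrightarrow> n \<bullet> z \<le> k"
    and pq: "p \<in> box_square c s a b h" "q \<in> box_square c s a b h" "p \<noteq> q" "n \<bullet> p = k" "n \<bullet> q = k"
  shows "c * fst n + s * snd n = 0 \<or> c * snd n - s * fst n = 0"
proof -
  define \<alpha> \<beta> where "\<alpha> = c * fst n + s * snd n" and "\<beta> = c * snd n - s * fst n"
  define X Y where "X z = c * fst z + s * snd z" and "Y z = c * snd z - s * fst z" for z :: "real \<times> real"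
  have eq: "\<alpha> * X z + \<beta> * Y z = n \<bullet> z" for z
  proof -
    have "\<alpha> * X z + \<beta> * Y z = (c\<^sup>2 + s\<^sup>2) * (n \<bullet> z)"
      by (simp add: \<alpha>_def \<beta>_def X_def Y_def inner_prod_def power2_eq_square algebra_simps)
    then show ?thesis using cs by simp
  qed
  have ne: "(X p, Y p) \<noteq> (X q, Y q)"
  proof
    assume e: "(X p, Y p) = (X q, Y q)"
    have "fst z = c * X z - s * Y z" "snd z = s * X z + c * Y z" for z
    proof -
      have "c * X z - s * Y z = (c\<^sup>2 + s\<^sup>2) * fst z" "s * X z + c * Y z = (c\<^sup>2 + s\<^sup>2) * snd z"
        by (simp_all add: X_def Y_def power2_eq_square algebra_simps)
      then show "fst z = c * X z - s * Y z" "snd z = s * X z + c * Y z" using cs by simp_all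
    qed
    then show False using e \<open>p \<noteq> q\<close> by (metis prod_eqI prod.inject)
  qed
  have bd: "a \<le> X z \<and> X z \<le> a + h \<and> b \<le> Y z \<and> Y z \<le> b + h \<longleftrightarrow> z \<in> box_square c s a b h" for z
    by (simp add: box_square_def X_def Y_def)
  have "\<alpha> = 0 \<or> \<beta> = 0"
  proof (rule box_square_linear_max_unique[where ?X1.0 = "X p" and ?Y1.0 = "Y p" and ?X2.0 = "X q" and ?Y2.0 = "Y q"])
    fix x y assume xy: "a \<le> x" "x \<le> a + h" "b \<le> y" "y \<le> b + h"
    define z where "z = (c * x - s * y, s * x + c * y)"
    have "X z = x" "Y z = y" using rotated_coordinates[OF cs] by (simp_all add: X_def Y_def z_def)
    then show "\<alpha> * x + \<beta> * y \<le> k" using eq[of z] le[of z] bd[of z] xy by simp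
  qed (use ne eq[of p] eq[of q] pq bd[of p] bd[of q] in simp_all)
  then show ?thesis by (simp add: \<alpha>_def \<beta>_def)
qed

text \<open>The mixed cases would make the inner product of the two directions vanish, but the
  normalisation keeps it positive. The other cases make the cross product vanish, and unit vectors
  with positive inner product and zero cross product coincide.\<close>

lemma normalised_direction_unique:
  fixes c s c' s' \<alpha> \<beta> :: real
  assumes "c > 0" "s \<ge> 0" "c\<^sup>2 + s\<^sup>2 = 1" "c' > 0" "s' \<ge> 0" "c'\<^sup>2 + s'\<^sup>2 = 1"
    and n: "\<alpha> \<noteq> 0 \<or> \<beta> \<noteq> 0"
    and 1: "c * \<alpha> + s * \<beta> = 0 \<or> c * \<beta> - s * \<alpha> = 0"
    and 2: "c' * \<alpha> + s' * \<beta> = 0 \<or> c' * \<beta> - s' * \<alpha> = 0"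
  shows "c = c' \<and> s = s'"
proof -
  have pos: "c * c' + s * s' > 0" using assms by (simp add: add_pos_nonneg)
  have cross: "c * s' - s * c' = 0"
  proof -
    have *: "(c * s' - s * c') * x = 0 \<and> (c * s' - s * c') * y = 0"
      if "c * x + s * y = 0" "c' * x + s' * y = 0" for x y
    proof -
      have "(c * s' - s * c') * x = s' * (c * x + s * y) - s * (c' * x + s' * y)"
        "(c * s' - s * c') * y = c * (c' * x + s' * y) - c' * (c * x + s * y)"
        by (simp_all add: algebra_simps)
      then show ?thesis using that by simp
    qed
    have **: "(c * c' + s * s') * x = 0 \<and> (c * c' + s * s') * y = 0"
      if "c * x + s * y = 0" "c' * y - s' * x = 0" for x y
    proof -
      have "(c * c' + s * s') * x = c' * (c * x + s * y) - s * (c' * y - s' * x)"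
        "(c * c' + s * s') * y = c * (c' * y - s' * x) + s' * (c * x + s * y)"
        by (simp_all add: algebra_simps)
      then show ?thesis using that by simp
    qed
    have ***: "(c * c' + s * s') * x = 0 \<and> (c * c' + s * s') * y = 0"
      if "c' * x + s' * y = 0" "c * y - s * x = 0" for x y
    proof -
      have "(c * c' + s * s') * x = c * (c' * x + s' * y) - s' * (c * y - s * x)"
        "(c * c' + s * s') * y = c' * (c * y - s * x) + s * (c' * x + s' * y)"
        by (simp_all add: algebra_simps)
      then show ?thesis using that by simp
    qed
    from 1 2 consider "c * \<alpha> + s * \<beta> = 0" "c' * \<alpha> + s' * \<beta> = 0"
      | "c * \<beta> - s * \<alpha> = 0" "c' * \<beta> - s' * \<alpha> = 0"
      | "c * \<alpha> + s * \<beta> = 0" "c' * \<beta> - s' * \<alpha> = 0"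
      | "c' * \<alpha> + s' * \<beta> = 0" "c * \<beta> - s * \<alpha> = 0" by blast
    then show ?thesis
    proof cases
      case 1 then show ?thesis using *[of \<alpha> \<beta>] n by auto
    next
      case 2 then show ?thesis using *[of \<beta> "- \<alpha>"] n by auto
    next
      case 3 then show ?thesis using **[of \<alpha> \<beta>] n pos by auto
    next
      case 4 then show ?thesis using ***[of \<alpha> \<beta>] n pos by auto
    qed
  qed
  have "(c * c' + s * s')\<^sup>2 + (c * s' - s * c')\<^sup>2 = (c\<^sup>2 + s\<^sup>2) * (c'\<^sup>2 + s'\<^sup>2)"
    by (simp add: power2_eq_square algebra_simps)
  then have "(c * c' + s * s')\<^sup>2 = 1" using cross assms by simp
  then have dot: "c * c' + s * s' = 1" using pos by (simp add: power2_eq_1_iff)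
  have "c = c * (c'\<^sup>2 + s'\<^sup>2)" using assms by simp
  also have "\<dots> = c' * (c * c' + s * s') + s' * (c * s' - s * c')"
    by (simp add: power2_eq_square algebra_simps)
  finally have c: "c = c'" using dot cross by simp
  have "s = s * (c'\<^sup>2 + s'\<^sup>2)" using assms by simp
  also have "\<dots> = s' * (c * c' + s * s') - c' * (c * s' - s * c')"
    by (simp add: power2_eq_square algebra_simps)
  finally have "s = s'" unfolding dot cross by simp
  with c show ?thesis by simp
qed

lemma parallel_if_two_common_points:
  assumes cs: "c > 0" "s \<ge> 0" "c\<^sup>2 + s\<^sup>2 = 1" "h > 0" and cs': "c' > 0" "s' \<ge> 0" "c'\<^sup>2 + s'\<^sup>2 = 1" "h' > 0"
    and disj: "interior (box_square c s a b h) \<inter> interior (box_square c' s' a' b' h') = {}"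
    and pq: "p \<in> box_square c s a b h \<inter> box_square c' s' a' b' h'"
      "q \<in> box_square c s a b h \<inter> box_square c' s' a' b' h'" "p \<noteq> q"
  shows "c = c' \<and> s = s'"
proof -
  let ?S = "box_square c s a b h" and ?T = "box_square c' s' a' b' h'"
  have ne: "interior ?S \<noteq> {}" "interior ?T \<noteq> {}"
    using interior_box_square_nonempty cs cs' by blast+
  obtain n k where n: "n \<noteq> 0" "\<forall>x\<in>interior ?S. n \<bullet> x \<le> k" "\<forall>x\<in>interior ?T. n \<bullet> x \<ge> k"
    using separating_hyperplane_sets[OF convex_interior[OF convex_box_square] convex_interior[OF convex_box_square] ne disj]
    by blast
  \<comment> \<open>A closed convex set with nonempty interior is the closure of its interior. So
    the separation extends to the whole squares, and common points lie on the separating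
    line.\<close>
  have clo: "closure (interior ?S) = ?S" "closure (interior ?T) = ?T"
    using ne by (simp_all add: convex_closure_interior convex_box_square closed_box_square)
  have "closure (interior ?S) \<subseteq> {x. n \<bullet> x \<le> k}"
    using n(2) by (intro closure_minimal closed_halfspace_le) auto
  then have S: "n \<bullet> x \<le> k" if "x \<in> ?S" for x using that clo by auto
  have "closure (interior ?T) \<subseteq> {x. n \<bullet> x \<ge> k}"
    using n(3) by (intro closure_minimal closed_halfspace_ge) auto
  then have T: "n \<bullet> x \<ge> k" if "x \<in> ?T" for x using that clo by auto
  have eq: "n \<bullet> p = k" "n \<bullet> q = k" using S[of p] T[of p] S[of q] T[of q] pq by auto
  have 1: "c * fst n + s * snd n = 0 \<or> c * snd n - s * fst n = 0"
    using box_square_supporting_line[OF cs(3) S] pq eq by blast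
  have "c' * fst (- n) + s' * snd (- n) = 0 \<or> c' * snd (- n) - s' * fst (- n) = 0"
    by (rule box_square_supporting_line[OF cs'(3), where k = "- k" and p = p and q = q])
      (use T pq eq in auto)
  then have 2: "c' * fst n + s' * snd n = 0 \<or> c' * snd n - s' * fst n = 0" by auto
  show ?thesis
    by (rule normalised_direction_unique[OF cs(1-3) cs'(1-3) _ 1 2]) (use n(1) in \<open>auto simp: prod_eq_iff\<close>)
qed

section \<open>Periodic tilings consist of parallel squares\<close>

definition lattice_point :: "real \<Rightarrow> int \<times> int \<Rightarrow> real \<times> real" where
  "lattice_point lam k = (of_int (fst k), of_int (snd k) * lam)"

lemma period_lattice_eq_range: "period_lattice lam = range (lattice_point lam)"
  unfolding period_lattice_def lattice_point_def by (auto simp: image_iff)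

lemma lattice_point_diff: "lattice_point lam (k - l) = lattice_point lam k - lattice_point lam l"
  by (simp add: lattice_point_def algebra_simps)

lemma lattice_point_minus: "lattice_point lam (- k) = - lattice_point lam k"
  by (simp add: lattice_point_def)

lemma lattice_point_eq_iff: "lam \<noteq> 0 \<Longrightarrow> lattice_point lam k = lattice_point lam l \<longleftrightarrow> k = l"
  by (auto simp: lattice_point_def prod_eq_iff)

lemma finite_lattice_points_bounded:
  assumes "lam > 0"
  shows "finite {k. norm (lattice_point lam k) \<le> M}"
proof -
  have "{k. norm (lattice_point lam k) \<le> M} \<subseteq> {- \<lceil>M\<rceil>..\<lceil>M\<rceil>} \<times> {- \<lceil>M / lam\<rceil>..\<lceil>M / lam\<rceil>}"
  proof
    fix k assume "k \<in> {k. norm (lattice_point lam k) \<le> M}"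
    then have "norm (fst (lattice_point lam k)) \<le> M \<and> norm (snd (lattice_point lam k)) \<le> M"
      using norm_fst_le[of "fst (lattice_point lam k)" "snd (lattice_point lam k)"]
        norm_snd_le[of "snd (lattice_point lam k)" "fst (lattice_point lam k)"] by simp
    then have m: "\<bar>of_int (fst k)\<bar> \<le> M" and "\<bar>of_int (snd k)\<bar> * lam \<le> M"
      using assms by (simp_all add: lattice_point_def abs_mult)
    then have n: "\<bar>of_int (snd k)\<bar> \<le> M / lam" using assms by (simp add: pos_le_divide_eq)
    have "real_of_int \<bar>fst k\<bar> \<le> of_int \<lceil>M\<rceil>" "real_of_int \<bar>snd k\<bar> \<le> of_int \<lceil>M / lam\<rceil>"
      using order_trans[OF m le_of_int_ceiling] order_trans[OF n le_of_int_ceiling] by simp_all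
    then have "\<bar>fst k\<bar> \<le> \<lceil>M\<rceil>" "\<bar>snd k\<bar> \<le> \<lceil>M / lam\<rceil>" unfolding of_int_le_iff by auto
    then show "k \<in> {- \<lceil>M\<rceil>..\<lceil>M\<rceil>} \<times> {- \<lceil>M / lam\<rceil>..\<lceil>M / lam\<rceil>}"
      by (cases k) auto
  qed
  then show ?thesis by (rule finite_subset) auto
qed

lemma closed_period_lattice: "closed (period_lattice lam)"
proof -
  have "period_lattice lam = \<int> \<times> (\<lambda>x. lam *\<^sub>R x) ` \<int>"
    by (auto simp: period_lattice_def Ints_def image_iff mult.commute)
  then show ?thesis by (simp only: closed_Times closed_scaling closed_Ints)
qed

text \<open>Equal translations reduce to disjointness inside \<open>\<Gamma>\<close>. Different ones
  would give two distinct simply equivalent points in the interior of the union.\<close>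

lemma tiling_translates_disjoint:
  assumes "lam > 0" and tiling: "periodic_square_tiling lam \<Gamma>" and ST: "S \<in> \<Gamma>" "T \<in> \<Gamma>"
    and x: "x - lattice_point lam k \<in> interior S" "x - lattice_point lam l \<in> interior T"
  shows "S = T \<and> k = l"
proof (cases "k = l")
  case True
  have "pairwise (\<lambda>S T. interior S \<inter> interior T = {}) \<Gamma>"
    using tiling by (simp add: periodic_square_tiling_def)
  then show ?thesis using x ST True by (auto simp: pairwise_def)
next
  case False
  let ?x = "x - lattice_point lam k" and ?y = "x - lattice_point lam l"
  have "?x \<in> interior (\<Union>\<Gamma>)" "?y \<in> interior (\<Union>\<Gamma>)"
    using x ST interior_mono[of S "\<Union>\<Gamma>"] interior_mono[of T "\<Union>\<Gamma>"] by blast+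
  moreover have "?x \<noteq> ?y" using False lattice_point_eq_iff assms(1) by auto
  moreover have "simply_equivalent lam ?x ?y"
    unfolding simply_equivalent_def period_lattice_eq_range
    by (rule bexI[OF _ rangeI[of _ "k - l"]]) (simp add: lattice_point_diff)
  ultimately show ?thesis using tiling unfolding periodic_square_tiling_def by blast
qed

lemma tiling_covers:
  assumes "periodic_square_tiling lam \<Gamma>"
  obtains S k where "S \<in> \<Gamma>" "z - lattice_point lam k \<in> S"
proof -
  obtain y where "y \<in> \<Union>\<Gamma>" "simply_equivalent lam z y"
    using assms unfolding periodic_square_tiling_def by blast
  then obtain S k where "S \<in> \<Gamma>" "z + lattice_point lam k \<in> S"
    unfolding simply_equivalent_def period_lattice_eq_range by blast
  then show ?thesis using that[of S "- k"] by (simp add: lattice_point_minus)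
qed

lemma mem_translation_iff: "z \<in> (+) v ` T \<longleftrightarrow> z - v \<in> T" for z :: "'a::ab_group_add"
proof
  assume "z - v \<in> T"
  then have "v + (z - v) \<in> (+) v ` T" by (rule imageI)
  then show "z \<in> (+) v ` T" by simp
qed auto

lemma tiling_squares_parallel:
  fixes cf sf af bf hf :: "(real \<times> real) set \<Rightarrow> real"
  assumes lam: "lam > 0" and tiling: "periodic_square_tiling lam \<Gamma>"
    and norm: "\<And>S. S \<in> \<Gamma> \<Longrightarrow> cf S > 0 \<and> sf S \<ge> 0 \<and> (cf S)\<^sup>2 + (sf S)\<^sup>2 = 1 \<and> hf S > 0"
    and box: "\<And>S. S \<in> \<Gamma> \<Longrightarrow> S = box_square (cf S) (sf S) (af S) (bf S) (hf S)"
    and ST: "S0 \<in> \<Gamma>" "T0 \<in> \<Gamma>"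
  shows "cf S0 = cf T0 \<and> sf S0 = sf T0"
proof -
  have finite: "finite \<Gamma>" using tiling by (simp add: periodic_square_tiling_def)
  have compact: "compact S" if "S \<in> \<Gamma>" for S
    by (subst box[OF that]) (simp add: compact_eq_bounded_closed bounded_box_square closed_box_square norm that)
  have int_ne: "interior S \<noteq> {}" if "S \<in> \<Gamma>" for S
    by (subst box[OF that]) (simp add: interior_box_square_nonempty norm that)
  have clo: "closure (interior S) = S" if "S \<in> \<Gamma>" for S
  proof -
    have "convex S" using box[OF that] convex_box_square by metis
    then show ?thesis using int_ne[OF that] compact[OF that]
      by (simp add: convex_closure_interior compact_imp_closed)
  qed
  define G where "G = period_lattice lam"
  \<comment> \<open>Each square contributes the sum of a compact set and the closed lattice, so
    \<open>U A\<close> is closed for finite \<open>A\<close>.\<close>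
  define U where "U A = (\<Union>S\<in>A. \<Union>x\<in>S. \<Union>g\<in>G. {x + g})" for A :: "(real \<times> real) set set"
  have in_U: "z \<in> U A \<longleftrightarrow> (\<exists>S\<in>A. \<exists>k. z - lattice_point lam k \<in> S)" for z A
  proof
    assume "z \<in> U A"
    then obtain S x k where "S \<in> A" "x \<in> S" "z = x + lattice_point lam k"
      by (auto simp: U_def G_def period_lattice_eq_range)
    then show "\<exists>S\<in>A. \<exists>k. z - lattice_point lam k \<in> S" by (intro bexI[of _ S] exI[of _ k]) auto
  next
    assume "\<exists>S\<in>A. \<exists>k. z - lattice_point lam k \<in> S"
    then obtain S k where "S \<in> A" "z - lattice_point lam k \<in> S" by blast
    moreover have "z = (z - lattice_point lam k) + lattice_point lam k" by simp
    ultimately show "z \<in> U A" unfolding U_def G_def period_lattice_eq_range by blast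
  qed
  have closed: "closed (U A)" if "A \<subseteq> \<Gamma>" for A
    unfolding U_def G_def
  proof (rule closed_UN)
    show "finite A" using that finite by (rule finite_subset)
    show "\<forall>S\<in>A. closed (\<Union>x\<in>S. \<Union>g\<in>period_lattice lam. {x + g})"
      using that compact compact_closed_sums[OF _ closed_period_lattice] by blast
  qed
  \<comment> \<open>An interior point of a square outside \<open>A\<close> would lie in a translate
    of a square of \<open>A\<close>. As squares are closures of their interiors, the interiors would
    overlap, which is impossible for different squares.\<close>
  have full: "A = \<Gamma>" if A: "A \<subseteq> \<Gamma>" "U A = UNIV" for A
  proof (rule ccontr)
    assume "A \<noteq> \<Gamma>"
    then obtain T where T: "T \<in> \<Gamma>" "T \<notin> A" using A(1) by blast
    obtain x where x: "x \<in> interior T" using int_ne[OF T(1)] by blast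
    obtain S k where S: "S \<in> A" "x - lattice_point lam k \<in> S" using in_U[of x A] A(2) by auto
    have "(+) (- lattice_point lam k) ` interior T \<inter> closure (interior S) \<noteq> {}"
      using S x clo[of S] A(1) by (auto simp: image_iff)
    then have "(+) (- lattice_point lam k) ` interior T \<inter> interior S \<noteq> {}"
      unfolding open_Int_closure_eq_empty[OF open_translation[OF open_interior]] .
    then obtain y where "y \<in> interior T" "y - lattice_point lam k \<in> interior S" by auto
    then have "y - lattice_point lam 0 \<in> interior T" "y - lattice_point lam k \<in> interior S"
      by (simp_all add: lattice_point_def zero_prod_def[symmetric])
    then have "T = S" using tiling_translates_disjoint[OF lam tiling] T(1) S(1) A(1) by blast
    then show False using S T by simp
  qed
  define A where "A = {S\<in>\<Gamma>. cf S = cf S0 \<and> sf S = sf S0}"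
  define B where "B = \<Gamma> - A"
  have AB: "A \<subseteq> \<Gamma>" "B \<subseteq> \<Gamma>" by (auto simp: A_def B_def)
  have cover: "U A \<union> U B = UNIV"
  proof -
    have "z \<in> U A \<union> U B" for z
    proof -
      obtain S k where S: "S \<in> \<Gamma>" "z - lattice_point lam k \<in> S"
        by (rule tiling_covers[OF tiling])
      then have "S \<in> A \<or> S \<in> B" by (simp add: B_def)
      then have "z \<in> U A \<or> z \<in> U B" unfolding in_U using S(2) by blast
      then show ?thesis by blast
    qed
    then show ?thesis by blast
  qed
  \<comment> \<open>A given translate of a square in \<open>A\<close> and one of a square in
    \<open>B\<close> share at most one point, since two common points would make them
    parallel.\<close>
  have meet: "p = q"
    if "S \<in> A" "T \<in> B"
      and p: "p - lattice_point lam k \<in> S" "p - lattice_point lam l \<in> T"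
      and q: "q - lattice_point lam k \<in> S" "q - lattice_point lam l \<in> T" for S T k l p q
  proof (rule ccontr)
    assume "p \<noteq> q"
    have S: "S \<in> \<Gamma>" and T: "T \<in> \<Gamma>" using that AB by auto
    let ?v = "lattice_point lam (l - k)"
    let ?a = "af T + (cf T * fst ?v + sf T * snd ?v)" and ?b = "bf T + (cf T * snd ?v - sf T * fst ?v)"
    have shift: "(+) ?v ` T = box_square (cf T) (sf T) ?a ?b (hf T)"
    proof -
      have "z - ?v \<in> T \<longleftrightarrow> z \<in> box_square (cf T) (sf T) ?a ?b (hf T)" for z
        by (subst box[OF T]) (auto simp: box_square_def algebra_simps)
      then show ?thesis by (intro set_eqI) (simp only: mem_translation_iff)
    qed
    have disj: "interior S \<inter> interior ((+) ?v ` T) = {}"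
    proof (rule ccontr)
      assume "interior S \<inter> interior ((+) ?v ` T) \<noteq> {}"
      then obtain x where "x \<in> interior S" "x - ?v \<in> interior T"
        unfolding interior_translation by (meson IntE ex_in_conv mem_translation_iff)
      then have "x - lattice_point lam 0 \<in> interior S" "x - ?v \<in> interior T"
        by (simp_all add: lattice_point_def zero_prod_def[symmetric])
      then have "S = T" using tiling_translates_disjoint[OF lam tiling S T] by blast
      then show False using that by (auto simp: B_def)
    qed
    let ?p = "p - lattice_point lam k" and ?q = "q - lattice_point lam k"
    have pT: "?p \<in> (+) ?v ` T" "?q \<in> (+) ?v ` T"
      using p q by (simp_all add: mem_translation_iff lattice_point_diff)
    have "cf S = cf T \<and> sf S = sf T"
    proof (rule parallel_if_two_common_points)
      show "interior (box_square (cf S) (sf S) (af S) (bf S) (hf S)) \<inter>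
        interior (box_square (cf T) (sf T) ?a ?b (hf T)) = {}"
        using disj unfolding shift box[OF S, symmetric] .
      show "?p \<in> box_square (cf S) (sf S) (af S) (bf S) (hf S) \<inter> box_square (cf T) (sf T) ?a ?b (hf T)"
        "?q \<in> box_square (cf S) (sf S) (af S) (bf S) (hf S) \<inter> box_square (cf T) (sf T) ?a ?b (hf T)"
        using pT p q unfolding shift box[OF S, symmetric] by auto
    qed (use norm S T \<open>p \<noteq> q\<close> in auto)
    then show False using that by (auto simp: A_def B_def)
  qed
  \<comment> \<open>There are countably many choices of two squares and two translations, each
    contributing at most one point.\<close>
  have "countable (U A \<inter> U B)"
  proof -
    define I where "I = (\<lambda>(S, T, k, l). {p. p - lattice_point lam k \<in> S \<and> p - lattice_point lam l \<in> T})"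
    have "U A \<inter> U B \<subseteq> (\<Union>i\<in>A \<times> B \<times> UNIV \<times> UNIV. I i)"
      by (auto simp: in_U I_def)
    moreover have "countable (\<Union>i\<in>A \<times> B \<times> UNIV \<times> UNIV. I i)"
    proof (rule countable_UN)
      have "countable A" "countable B" using AB finite by (auto intro: countable_finite finite_subset)
      then show "countable (A \<times> B \<times> (UNIV :: (int \<times> int) set) \<times> (UNIV :: (int \<times> int) set))"
        by (intro countable_SIGMA) auto
    next
      fix i :: "(real \<times> real) set \<times> (real \<times> real) set \<times> (int \<times> int) \<times> (int \<times> int)"
      assume i: "i \<in> A \<times> B \<times> UNIV \<times> UNIV"
      then obtain S T k l where STkl: "i = (S, T, k, l)" "S \<in> A" "T \<in> B" by blast
      have "p = q" if "p \<in> I i" "q \<in> I i" for p q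
        using that meet[OF STkl(2,3)] unfolding I_def STkl(1) by blast
      then have "I i = {} \<or> (\<exists>p. I i = {p})" by blast
      then show "countable (I i)" by auto
    qed
    ultimately show ?thesis by (rule countable_subset)
  qed
  \<comment> \<open>On this connected complement the closed sets \<open>U A\<close> and
    \<open>U B\<close> are disjoint, so one of them is the whole plane.\<close>
  then have "connected (- (U A \<inter> U B))"
    by (intro path_connected_imp_connected path_connected_complement_countable) auto
  then have "- U A \<inter> - (U A \<inter> U B) = {} \<or> - U B \<inter> - (U A \<inter> U B) = {}"
    using closed[OF AB(1)] closed[OF AB(2)] cover by (intro connectedD) auto
  then have "U A = UNIV \<or> U B = UNIV" by blast
  then have "A = \<Gamma> \<or> B = \<Gamma>" using full AB by blast
  moreover have "S0 \<notin> B" using ST by (simp add: A_def B_def)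
  ultimately have "T0 \<in> A" using ST by blast
  then show ?thesis by (simp add: A_def)
qed

section \<open>Half-open tiles\<close>

text \<open>Half-open rectangles make a tiling a genuine partition of the plane, with no exception
  on boundaries. \<open>I\<close> indexes the tiles of one period; \<open>tx\<close> and
  \<open>ty\<close> are the components of the translations.\<close>

definition exact_cover :: "'i set \<Rightarrow> ('i \<Rightarrow> real) \<Rightarrow> ('i \<Rightarrow> real) \<Rightarrow> ('i \<Rightarrow> real) \<Rightarrow> ('i \<Rightarrow> real) \<Rightarrow>
    ('k \<Rightarrow> real) \<Rightarrow> ('k \<Rightarrow> real) \<Rightarrow> bool" where
  "exact_cover I a b c d tx ty \<longleftrightarrow> (\<forall>x y. \<exists>!l. l \<in> I \<times> UNIV \<and>
     a (fst l) \<le> x - tx (snd l) \<and> x - tx (snd l) < b (fst l) \<and>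
     c (fst l) \<le> y - ty (snd l) \<and> y - ty (snd l) < d (fst l))"

text \<open>The points approach \<open>x\<close> from the right: the limit keeps the closed bound
  \<open>a\<close>, and any single one of them gives the strict bound \<open>b\<close>.\<close>

lemma half_open_interval_approach:
  fixes x a b :: real
  assumes inf: "infinite N" and N: "\<And>n. n \<in> N \<Longrightarrow> a \<le> x + 1 / of_nat (Suc n) \<and> x + 1 / of_nat (Suc n) \<le> b"
  shows "a \<le> x \<and> x < b"
proof
  show "a \<le> x"
  proof (rule ccontr)
    assume "\<not> a \<le> x"
    then obtain m where m: "1 / of_nat (Suc m) < a - x" using nat_approx_posE[of "a - x"] by auto
    obtain n where n: "n \<in> N" "n > m" using inf unfolding infinite_nat_iff_unbounded by blast
    have "1 / real (Suc n) \<le> 1 / real (Suc m)" using n(2) by (intro divide_left_mono) auto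
    then show False using N[OF n(1)] m by linarith
  qed
  obtain n where "n \<in> N" using inf by (metis finite.emptyI all_not_in_conv)
  moreover have "1 / real (Suc n) > 0" by simp
  ultimately show "x < b" using N[of n] by linarith
qed

text \<open>For existence, a point is approached along the diagonal of the rotated frame: one
  translated square contains infinitely many approach points, and its half-open version contains the
  limit. For uniqueness, a small diagonal push moves the point into the interiors of both
  tiles.\<close>

lemma tiling_half_open:
  assumes lam: "lam > 0" and tiling: "periodic_square_tiling lam \<Gamma>"
  obtains c s and a b h :: "(real \<times> real) set \<Rightarrow> real" where "c > 0" "s \<ge> 0" "c\<^sup>2 + s\<^sup>2 = 1"
    "\<And>S. S \<in> \<Gamma> \<Longrightarrow> h S > 0"
    "exact_cover \<Gamma> a (\<lambda>S. a S + h S) b (\<lambda>S. b S + h S)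
       (\<lambda>k. c * fst (lattice_point lam k) + s * snd (lattice_point lam k))
       (\<lambda>k. c * snd (lattice_point lam k) - s * fst (lattice_point lam k))"
proof -
  have finite: "finite \<Gamma>" using tiling by (simp add: periodic_square_tiling_def)
  have "\<forall>S. \<exists>c s a b h. S \<in> \<Gamma> \<longrightarrow> c > 0 \<and> s \<ge> 0 \<and> c\<^sup>2 + s\<^sup>2 = 1 \<and> h > 0 \<and> S = box_square c s a b h"
  proof
    fix S
    show "\<exists>c s a b h. S \<in> \<Gamma> \<longrightarrow> c > 0 \<and> s \<ge> 0 \<and> c\<^sup>2 + s\<^sup>2 = 1 \<and> h > 0 \<and> S = box_square c s a b h"
    proof (cases "S \<in> \<Gamma>")
      case True
      then have "is_square S" using tiling by (simp add: periodic_square_tiling_def)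
      then show ?thesis by (elim is_square_imp_box_square) blast
    qed simp
  qed
  then obtain cf sf a b h where *: "\<And>S. S \<in> \<Gamma> \<Longrightarrow> cf S > 0 \<and> sf S \<ge> 0 \<and> (cf S)\<^sup>2 + (sf S)\<^sup>2 = 1 \<and>
      h S > 0 \<and> S = box_square (cf S) (sf S) (a S) (b S) (h S)"
    by metis
  obtain S0 where S0: "S0 \<in> \<Gamma>" using tiling_covers[OF tiling, of 0] by blast
  define c s where "c = cf S0" and "s = sf S0"
  have cs: "c > 0" "s \<ge> 0" "c\<^sup>2 + s\<^sup>2 = 1" using *[OF S0] by (auto simp: c_def s_def)
  have "cf S = c \<and> sf S = s" if "S \<in> \<Gamma>" for S
    unfolding c_def s_def
    by (rule tiling_squares_parallel[OF lam tiling, where af = a and bf = b and hf = h]) (use * that S0 in blast)+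
  then have box: "S = box_square c s (a S) (b S) (h S)" and h: "h S > 0" if "S \<in> \<Gamma>" for S
    using *[OF that] that by metis+
  define X Y where "X z = c * fst z + s * snd z" and "Y z = c * snd z - s * fst z" for z :: "real \<times> real"
  have XY_add: "X (z + w) = X z + X w" "Y (z + w) = Y z + Y w" "X (z - w) = X z - X w" "Y (z - w) = Y z - Y w" for z w
    by (simp_all add: X_def Y_def algebra_simps)
  have inbox: "z \<in> S \<longleftrightarrow> a S \<le> X z \<and> X z \<le> a S + h S \<and> b S \<le> Y z \<and> Y z \<le> b S + h S" if "S \<in> \<Gamma>" for z S
    by (subst box[OF that]) (simp add: box_square_def X_def Y_def)
  have inint: "z \<in> interior S" if "S \<in> \<Gamma>" "a S < X z" "X z < a S + h S" "b S < Y z" "Y z < b S + h S" for z S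
    by (subst box[OF that(1)], rule subsetD[OF interior_box_square_superset]) (use that in \<open>simp add: X_def Y_def\<close>)
  define d where "d t = (c * t - s * t, s * t + c * t)" for t :: real
  have Xd: "X (d t) = t" "Y (d t) = t" for t
    using rotated_coordinates[OF cs(3), of t t] by (simp_all add: X_def Y_def d_def)
  define H where "H S k z \<longleftrightarrow> S \<in> \<Gamma> \<and> a S \<le> X (z - lattice_point lam k) \<and> X (z - lattice_point lam k) < a S + h S \<and>
     b S \<le> Y (z - lattice_point lam k) \<and> Y (z - lattice_point lam k) < b S + h S" for S k z
  have ex: "\<exists>S k. H S k z" for z
  proof -
    define w where "w n = z + d (1 / real (Suc n))" for n :: nat
    have "\<forall>n. \<exists>p. fst p \<in> \<Gamma> \<and> w n - lattice_point lam (snd p) \<in> fst p"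
      using tiling_covers[OF tiling] by (metis fst_conv snd_conv)
    then obtain p where p: "\<And>n. fst (p n) \<in> \<Gamma>" "\<And>n. w n - lattice_point lam (snd (p n)) \<in> fst (p n)" by metis
    \<comment> \<open>Bounded tiles leave only finitely many translations near \<open>z\<close>, as
      the pigeonhole argument requires.\<close>
    have "bounded (\<Union>\<Gamma>)"
    proof (rule bounded_Union[OF finite])
      show "\<forall>S\<in>\<Gamma>. bounded S" using box bounded_box_square[OF cs(3)] by metis
    qed
    then obtain M where M: "\<And>v. v \<in> \<Union>\<Gamma> \<Longrightarrow> norm v \<le> M" by (auto simp: bounded_iff)
    have "norm (w n) \<le> norm z + 2 * (\<bar>c\<bar> + \<bar>s\<bar>)" for n
    proof -
      let ?t = "1 / real (Suc n)"
      have t: "\<bar>?t\<bar> \<le> 1" by simp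
      have "norm (d ?t) \<le> \<bar>c * ?t - s * ?t\<bar> + \<bar>s * ?t + c * ?t\<bar>"
        unfolding d_def by (metis norm_Pair_le real_norm_def)
      also have "\<dots> = (\<bar>c - s\<bar> + \<bar>s + c\<bar>) * \<bar>?t\<bar>"
        by (simp only: left_diff_distrib[symmetric] distrib_right[symmetric] abs_mult)
      also have "\<dots> \<le> (\<bar>c - s\<bar> + \<bar>s + c\<bar>) * 1" using t by (intro mult_left_mono) auto
      also have "\<dots> \<le> 2 * (\<bar>c\<bar> + \<bar>s\<bar>)" using cs(1,2) by (auto simp: abs_if)
      finally show ?thesis unfolding w_def using norm_triangle_ineq[of z "d ?t"] by linarith
    qed
    moreover have "norm (w n - lattice_point lam (snd (p n))) \<le> M" for n using M p by blast
    ultimately have bd: "norm (lattice_point lam (snd (p n))) \<le> M + (norm z + 2 * (\<bar>c\<bar> + \<bar>s\<bar>))" for n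
      by (smt (verit) norm_minus_commute norm_triangle_sub)
    have "range p \<subseteq> \<Gamma> \<times> {k. norm (lattice_point lam k) \<le> M + (norm z + 2 * (\<bar>c\<bar> + \<bar>s\<bar>))}"
    proof (rule image_subsetI)
      fix n show "p n \<in> \<Gamma> \<times> {k. norm (lattice_point lam k) \<le> M + (norm z + 2 * (\<bar>c\<bar> + \<bar>s\<bar>))}"
        using p(1)[of n] bd[of n] by (simp add: mem_Times_iff)
    qed
    then have "finite (range p)"
      using finite_lattice_points_bounded[OF lam] finite by (meson finite_SigmaI finite_subset)
    then obtain n0 where inf: "infinite {n. p n = p n0}"
      using pigeonhole_infinite[of UNIV p] by auto
    let ?S = "fst (p n0)" and ?k = "snd (p n0)"
    have S: "?S \<in> \<Gamma>" by (rule p)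
    have mem: "w n - lattice_point lam ?k \<in> ?S" if "n \<in> {n. p n = p n0}" for n
      using p(2)[of n] that by simp
    have Xw: "X (w n - lattice_point lam ?k) = X (z - lattice_point lam ?k) + 1 / real (Suc n)"
      "Y (w n - lattice_point lam ?k) = Y (z - lattice_point lam ?k) + 1 / real (Suc n)" for n
      by (simp_all add: w_def XY_add Xd del: of_nat_Suc)
    have "a ?S \<le> X (z - lattice_point lam ?k) \<and> X (z - lattice_point lam ?k) < a ?S + h ?S"
      using mem inbox[OF S] Xw by (intro half_open_interval_approach[OF inf]) metis
    moreover have "b ?S \<le> Y (z - lattice_point lam ?k) \<and> Y (z - lattice_point lam ?k) < b ?S + h ?S"
      using mem inbox[OF S] Xw by (intro half_open_interval_approach[OF inf]) metis
    ultimately have "H ?S ?k z" using S by (simp add: H_def)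
    then show ?thesis by blast
  qed
  have uniq: "S = T \<and> k = l" if H: "H S k z" "H T l z" for S T k l z
  proof -
    define u v where "u = z - lattice_point lam k" and "v = z - lattice_point lam l"
    have u: "S \<in> \<Gamma>" "a S \<le> X u" "X u < a S + h S" "b S \<le> Y u" "Y u < b S + h S"
      and v: "T \<in> \<Gamma>" "a T \<le> X v" "X v < a T + h T" "b T \<le> Y v" "Y v < b T + h T"
      using H by (auto simp: H_def u_def v_def)
    \<comment> \<open>The least distance to the upper bounds of both tiles: a shorter diagonal push
      respects these and makes the lower bounds strict.\<close>
    define m where "m = Min {a S + h S - X u, b S + h S - Y u, a T + h T - X v, b T + h T - Y v}"
    have "m > 0" using u v by (simp add: m_def)
    then obtain t where t: "0 < t" "t < m" using dense by blast
    have "t < a S + h S - X u" "t < b S + h S - Y u" "t < a T + h T - X v" "t < b T + h T - Y v"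
      using t(2) by (simp_all add: m_def)
    then have "u + d t \<in> interior S" "v + d t \<in> interior T"
      using u v t by (auto intro!: inint simp: XY_add Xd)
    then show ?thesis
      using tiling_translates_disjoint[OF lam tiling u(1) v(1), of "z + d t" k l]
      by (simp add: u_def v_def algebra_simps)
  qed
  have "exact_cover \<Gamma> a (\<lambda>S. a S + h S) b (\<lambda>S. b S + h S)
       (\<lambda>k. c * fst (lattice_point lam k) + s * snd (lattice_point lam k))
       (\<lambda>k. c * snd (lattice_point lam k) - s * fst (lattice_point lam k))"
    unfolding exact_cover_def
  proof (intro allI)
    fix x y :: real
    define z where "z = (c * x - s * y, s * x + c * y)"
    have z: "X z = x" "Y z = y" using rotated_coordinates[OF cs(3)] by (simp_all add: X_def Y_def z_def)
    obtain S k where Sk: "H S k z" using ex by blast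
    have "\<exists>!l. H (fst l) (snd l) z"
    proof (rule ex1I[of _ "(S, k)"])
      fix l assume "H (fst l) (snd l) z"
      then have "fst l = S \<and> snd l = k" using uniq Sk by blast
      then show "l = (S, k)" by (simp add: prod_eq_iff)
    qed (use Sk in simp)
    moreover have "H (fst l) (snd l) z \<longleftrightarrow> l \<in> \<Gamma> \<times> UNIV \<and>
       a (fst l) \<le> x - (c * fst (lattice_point lam (snd l)) + s * snd (lattice_point lam (snd l))) \<and>
       x - (c * fst (lattice_point lam (snd l)) + s * snd (lattice_point lam (snd l))) < a (fst l) + h (fst l) \<and>
       b (fst l) \<le> y - (c * snd (lattice_point lam (snd l)) - s * fst (lattice_point lam (snd l))) \<and>
       y - (c * snd (lattice_point lam (snd l)) - s * fst (lattice_point lam (snd l))) < b (fst l) + h (fst l)" for l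
      unfolding H_def XY_add z by (auto simp: X_def Y_def mem_Times_iff)
    ultimately show "\<exists>!l. l \<in> \<Gamma> \<times> UNIV \<and>
       a (fst l) \<le> x - (c * fst (lattice_point lam (snd l)) + s * snd (lattice_point lam (snd l))) \<and>
       x - (c * fst (lattice_point lam (snd l)) + s * snd (lattice_point lam (snd l))) < a (fst l) + h (fst l) \<and>
       b (fst l) \<le> y - (c * snd (lattice_point lam (snd l)) - s * fst (lattice_point lam (snd l))) \<and>
       y - (c * snd (lattice_point lam (snd l)) - s * fst (lattice_point lam (snd l))) < b (fst l) + h (fst l)"
      by simp
  qed
  from that[OF cs _ this] h show ?thesis by blast
qed

section \<open>Additive areas\<close>

text \<open>The value 0 for empty intervals lets tiles that do not meet contribute nothing once
  their ends are clipped by \<open>max\<close> and \<open>min\<close>.\<close>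

definition mass :: "(real \<Rightarrow> real) \<Rightarrow> real \<Rightarrow> real \<Rightarrow> real" where
  "mass f a b = (if a < b then f b - f a else 0)"

text \<open>The weight of the grid cell starting at \<open>x\<close>. The default 0 concerns points
  without a later grid point, which never lie in \<open>[a, b)\<close> when \<open>b\<close> is in
  the grid.\<close>

definition jump :: "(real \<Rightarrow> real) \<Rightarrow> real set \<Rightarrow> real \<Rightarrow> real" where
  "jump f X x = (if \<exists>y\<in>X. x < y then f (Min {y\<in>X. x < y}) - f x else 0)"

text \<open>Counting the grid points in a half-open interval with weight \<open>jump f X\<close> gives its mass, which
  reduces additivity of areas to sums over disjoint finite sets.\<close>

lemma sum_jump:
  assumes "finite X" "a \<in> X" "b \<in> X"
  shows "(\<Sum>x | x \<in> X \<and> a \<le> x \<and> x < b. jump f X x) = mass f a b"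
  using assms(2)
proof (induction "card {x\<in>X. a \<le> x \<and> x < b}" arbitrary: a)
  case 0
  then have e: "{x\<in>X. a \<le> x \<and> x < b} = {}" using assms(1) by simp
  with 0 have "\<not> a < b" by auto
  then show ?case unfolding e by (simp add: mass_def)
next
  case (Suc n)
  then have "{x\<in>X. a \<le> x \<and> x < b} \<noteq> {}" by (metis card.empty nat.distinct(1))
  then have ab: "a < b" by auto
  \<comment> \<open>The sum telescopes through the successor \<open>c\<close> of \<open>a\<close> in
    \<open>X\<close>: \<open>a\<close> contributes \<open>f c - f a\<close>, and induction covers
    the rest.\<close>
  define N where "N = {y\<in>X. a < y}"
  have N: "finite N" "b \<in> N" using assms ab by (auto simp: N_def)
  define c where "c = Min N"
  have c: "c \<in> N" "\<And>y. y \<in> N \<Longrightarrow> c \<le> y"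
    unfolding c_def using N(1) Min_in[OF N(1)] N(2) by blast (simp add: N(1))
  then have cX: "c \<in> X" "a < c" "c \<le> b" using N by (auto simp: N_def)
  have eq: "{x\<in>X. a \<le> x \<and> x < b} = insert a {x\<in>X. c \<le> x \<and> x < b}"
  proof (intro set_eqI iffI)
    fix x assume "x \<in> {x\<in>X. a \<le> x \<and> x < b}"
    then show "x \<in> insert a {x\<in>X. c \<le> x \<and> x < b}" using c(2)[of x] by (cases "x = a") (auto simp: N_def)
  qed (use Suc.prems ab cX in auto)
  have fin: "finite {x\<in>X. c \<le> x \<and> x < b}" using assms by simp
  have ni: "a \<notin> {x\<in>X. c \<le> x \<and> x < b}" using cX by simp
  have "n = card {x\<in>X. c \<le> x \<and> x < b}" using Suc.hyps(2) fin ni unfolding eq by simp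
  from Suc.hyps(1)[OF this cX(1)] have IH: "(\<Sum>x | x \<in> X \<and> c \<le> x \<and> x < b. jump f X x) = mass f c b" .
  have "jump f X a = f c - f a"
    using c cX by (auto simp: jump_def c_def N_def)
  then show ?case unfolding eq using fin ni IH cX ab by (auto simp: mass_def)
qed

text \<open>By distributivity the area of a rectangle with corners on the grid becomes a sum of
  weights over the grid points it contains.\<close>

lemma mass_prod_eq_sum_jump:
  assumes "finite X" "a \<in> X" "b \<in> X" "finite Y" "c \<in> Y" "d \<in> Y"
  shows "mass f a b * mass g c d = (\<Sum>(x,y)\<in>X\<times>Y.
    if a \<le> x \<and> x < b \<and> c \<le> y \<and> y < d then jump f X x * jump g Y y else 0)"
proof -
  have "mass f a b * mass g c d = (\<Sum>x\<in>X. if a \<le> x \<and> x < b then jump f X x else 0) *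
      (\<Sum>y\<in>Y. if c \<le> y \<and> y < d then jump g Y y else 0)"
    using assms by (simp add: sum_jump[symmetric] sum.inter_filter)
  also have "\<dots> = (\<Sum>(x,y)\<in>X\<times>Y. (if a \<le> x \<and> x < b then jump f X x else 0) * (if c \<le> y \<and> y < d then jump g Y y else 0))"
    by (simp add: sum_product sum.cartesian_product)
  also have "\<dots> = (\<Sum>(x,y)\<in>X\<times>Y.
    if a \<le> x \<and> x < b \<and> c \<le> y \<and> y < d then jump f X x * jump g Y y else 0)"
    by (intro sum.cong) auto
  finally show ?thesis .
qed

text \<open>All clipped tiles have their corners on one finite grid. Each grid point of the
  rectangle lies in exactly one tile, so exchanging the sums over tiles and grid points collapses
  the inner sum.\<close>

lemma mass_prod_decompose:
  fixes a b c d :: real and a' b' c' d' :: "'l \<Rightarrow> real"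
  assumes "finite L"
    and ex1: "\<And>x y. a \<le> x \<Longrightarrow> x < b \<Longrightarrow> c \<le> y \<Longrightarrow> y < d \<Longrightarrow>
      \<exists>!l. l \<in> L \<and> a' l \<le> x \<and> x < b' l \<and> c' l \<le> y \<and> y < d' l"
  shows "mass f a b * mass g c d =
    (\<Sum>l\<in>L. mass f (max a (a' l)) (min b (b' l)) * mass g (max c (c' l)) (min d (d' l)))"
proof -
  define X where "X = {a, b} \<union> (\<lambda>l. max a (a' l)) ` L \<union> (\<lambda>l. min b (b' l)) ` L"
  define Y where "Y = {c, d} \<union> (\<lambda>l. max c (c' l)) ` L \<union> (\<lambda>l. min d (d' l)) ` L"
  have fin: "finite X" "finite Y" using assms(1) by (auto simp: X_def Y_def)
  define R where "R x y \<longleftrightarrow> a \<le> x \<and> x < b \<and> c \<le> y \<and> y < d" for x y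
  define P where "P l x y \<longleftrightarrow> a' l \<le> x \<and> x < b' l \<and> c' l \<le> y \<and> y < d' l" for l x y
  define w where "w x y = jump f X x * jump g Y y" for x y
  have "(\<Sum>l\<in>L. mass f (max a (a' l)) (min b (b' l)) * mass g (max c (c' l)) (min d (d' l)))
    = (\<Sum>l\<in>L. \<Sum>(x,y)\<in>X\<times>Y. if R x y \<and> P l x y then w x y else 0)"
  proof (rule sum.cong[OF refl])
    fix l assume "l \<in> L"
    then have "mass f (max a (a' l)) (min b (b' l)) * mass g (max c (c' l)) (min d (d' l)) =
      (\<Sum>(x,y)\<in>X\<times>Y. if max a (a' l) \<le> x \<and> x < min b (b' l) \<and> max c (c' l) \<le> y \<and> y < min d (d' l)
         then jump f X x * jump g Y y else 0)"
      by (intro mass_prod_eq_sum_jump fin) (auto simp: X_def Y_def)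
    also have "\<dots> = (\<Sum>(x,y)\<in>X\<times>Y. if R x y \<and> P l x y then w x y else 0)"
      by (intro sum.cong) (auto simp: R_def P_def w_def)
    finally show "mass f (max a (a' l)) (min b (b' l)) * mass g (max c (c' l)) (min d (d' l)) = \<dots>" .
  qed
  also have "\<dots> = (\<Sum>(x,y)\<in>X\<times>Y. \<Sum>l\<in>L. if R x y \<and> P l x y then w x y else 0)"
    by (subst sum.swap) (simp add: case_prod_unfold)
  also have "\<dots> = (\<Sum>(x,y)\<in>X\<times>Y. if R x y then w x y else 0)"
  proof (rule sum.cong[OF refl], clarify)
    fix x y
    show "(\<Sum>l\<in>L. if R x y \<and> P l x y then w x y else 0) = (if R x y then w x y else 0)"
    proof (cases "R x y")
      case True
      then have "\<exists>!l. l \<in> L \<and> P l x y" unfolding P_def using ex1[of x y] by (auto simp: R_def)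
      then obtain l where l: "l \<in> L" "P l x y" "\<And>l'. l' \<in> L \<Longrightarrow> P l' x y \<Longrightarrow> l' = l" by blast
      have "(\<Sum>l'\<in>L. if R x y \<and> P l' x y then w x y else 0) = (\<Sum>l'\<in>L. if l' = l then w x y else 0)"
      proof (rule sum.cong[OF refl])
        fix l' assume "l' \<in> L"
        then have "P l' x y \<longleftrightarrow> l' = l" using l by metis
        then show "(if R x y \<and> P l' x y then w x y else 0) = (if l' = l then w x y else 0)"
          using True by simp
      qed
      then show ?thesis using l(1) assms(1) True by simp
    qed simp
  qed
  also have "\<dots> = mass f a b * mass g c d"
    unfolding R_def w_def by (intro mass_prod_eq_sum_jump[symmetric] fin) (auto simp: X_def Y_def)
  finally show ?thesis by simp
qed

lemma mass_translate:
  assumes "Modules.additive f"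
  shows "mass f (a + t) (b + t) = mass f a b"
  by (simp add: mass_def Modules.additive.add[OF assms])

text \<open>Double counting: \<open>m i j k\<close> is the area of the overlap of tile
  \<open>i\<close> with tile \<open>j\<close> shifted by translation \<open>k\<close>. Summing over
  \<open>j\<close> and \<open>k\<close> recovers tile \<open>i\<close>; summing over
  \<open>i\<close> and \<open>k\<close> recovers tile \<open>j\<close>.\<close>

lemma mass_prod_sum_eq:
  fixes a b c d :: "'i \<Rightarrow> real" and a' b' c' d' :: "'j \<Rightarrow> real" and tx ty :: "'k \<Rightarrow> real"
  assumes fin: "finite I" "finite J" "finite K" and add: "Modules.additive f" "Modules.additive g"
    and ex1: "\<And>i x y. i \<in> I \<Longrightarrow> a i \<le> x \<Longrightarrow> x < b i \<Longrightarrow> c i \<le> y \<Longrightarrow> y < d i \<Longrightarrow>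
      \<exists>!l. l \<in> J \<times> K \<and> a' (fst l) \<le> x - tx (snd l) \<and> x - tx (snd l) < b' (fst l) \<and>
        c' (fst l) \<le> y - ty (snd l) \<and> y - ty (snd l) < d' (fst l)"
    and ex2: "\<And>j x y. j \<in> J \<Longrightarrow> a' j \<le> x \<Longrightarrow> x < b' j \<Longrightarrow> c' j \<le> y \<Longrightarrow> y < d' j \<Longrightarrow>
      \<exists>!l. l \<in> I \<times> K \<and> a (fst l) \<le> x + tx (snd l) \<and> x + tx (snd l) < b (fst l) \<and>
        c (fst l) \<le> y + ty (snd l) \<and> y + ty (snd l) < d (fst l)"
  shows "(\<Sum>i\<in>I. mass f (a i) (b i) * mass g (c i) (d i)) =
    (\<Sum>j\<in>J. mass f (a' j) (b' j) * mass g (c' j) (d' j))"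
proof -
  define m where "m i j k =
     mass f (max (a i) (a' j + tx k)) (min (b i) (b' j + tx k)) *
     mass g (max (c i) (c' j + ty k)) (min (d i) (d' j + ty k))" for i j k
  \<comment> \<open>The same piece seen from tile \<open>j\<close>: shifting it back keeps its area
    because \<open>f\<close> and \<open>g\<close> are additive.\<close>
  have m': "m i j k = mass f (max (a' j) (a i - tx k)) (min (b' j) (b i - tx k)) *
     mass g (max (c' j) (c i - ty k)) (min (d' j) (d i - ty k))" for i j k
  proof -
    have "max (a i) (a' j + tx k) = max (a' j) (a i - tx k) + tx k"
      "min (b i) (b' j + tx k) = min (b' j) (b i - tx k) + tx k"
      "max (c i) (c' j + ty k) = max (c' j) (c i - ty k) + ty k"
      "min (d i) (d' j + ty k) = min (d' j) (d i - ty k) + ty k" by auto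
    then show ?thesis by (simp only: m_def mass_translate[OF add(1)] mass_translate[OF add(2)])
  qed
  have "(\<Sum>i\<in>I. mass f (a i) (b i) * mass g (c i) (d i)) = (\<Sum>i\<in>I. \<Sum>l\<in>J\<times>K. m i (fst l) (snd l))"
  proof (rule sum.cong[OF refl])
    fix i assume "i \<in> I"
    then show "mass f (a i) (b i) * mass g (c i) (d i) = (\<Sum>l\<in>J\<times>K. m i (fst l) (snd l))"
      unfolding m_def using fin(2,3) ex1[of i]
      by (intro mass_prod_decompose) (simp_all only: le_diff_eq diff_less_eq finite_cartesian_product)
  qed
  also have "\<dots> = (\<Sum>i\<in>I. \<Sum>j\<in>J. \<Sum>k\<in>K. m i j k)"
    by (simp add: sum.cartesian_product case_prod_unfold)
  also have "\<dots> = (\<Sum>j\<in>J. \<Sum>i\<in>I. \<Sum>k\<in>K. m i j k)" by (rule sum.swap)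
  also have "\<dots> = (\<Sum>j\<in>J. \<Sum>l\<in>I\<times>K. m (fst l) j (snd l))"
    by (simp add: sum.cartesian_product case_prod_unfold)
  also have "\<dots> = (\<Sum>j\<in>J. mass f (a' j) (b' j) * mass g (c' j) (d' j))"
  proof (rule sum.cong[OF refl])
    fix j assume "j \<in> J"
    then show "(\<Sum>l\<in>I\<times>K. m (fst l) j (snd l)) = mass f (a' j) (b' j) * mass g (c' j) (d' j)"
      unfolding m' using fin(1,3) ex2[of j]
      by (intro mass_prod_decompose[symmetric])
        (simp_all only: diff_le_eq less_diff_eq finite_cartesian_product)
  qed
  finally show ?thesis .
qed

section \<open>The Pythagorean fundamental domain\<close>

text \<open>Steps of at least \<delta> make \<psi> increasing and unbounded in both
  directions.\<close>

lemma unique_step: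
  fixes \<psi> :: "int \<Rightarrow> real"
  assumes "\<delta> > 0" and step: "\<And>n. \<psi> n + \<delta> \<le> \<psi> (n + 1)"
  shows "\<exists>!n. \<psi> n \<le> y \<and> y < \<psi> (n + 1)"
proof -
  have grow: "\<psi> n + of_nat k * \<delta> \<le> \<psi> (n + int k)" for n k
  proof (induction k)
    case (Suc k)
    then show ?case using step[of "n + int k"] by (simp add: algebra_simps)
  qed simp
  have mono: "\<psi> m \<le> \<psi> n" if "m \<le> n" for m n
    using grow[of m "nat (n - m)"] that \<open>\<delta> > 0\<close> by (simp add: order_trans[rotated])
  obtain i :: nat where i: "\<psi> 0 - y < of_nat i * \<delta>" using \<open>\<delta> > 0\<close> reals_Archimedean3 by blast
  define n0 where "n0 = - int i"
  have n0: "\<psi> n0 \<le> y" using grow[of n0 i] i by (simp add: n0_def)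
  obtain j :: nat where j: "y - \<psi> n0 < of_nat j * \<delta>" using \<open>\<delta> > 0\<close> reals_Archimedean3 by blast
  have ex: "\<exists>k. y < \<psi> (n0 + int k)" using grow[of n0 j] j by (intro exI[of _ j]) simp
  define k where "k = (LEAST k. y < \<psi> (n0 + int k))"
  have k: "y < \<psi> (n0 + int k)" unfolding k_def by (rule LeastI_ex[OF ex])
  have "k \<noteq> 0" using k n0 by (cases k) auto
  then obtain k' where k': "k = Suc k'" by (cases k) auto
  have "\<not> y < \<psi> (n0 + int k')" using not_less_Least[of k' "\<lambda>k. y < \<psi> (n0 + int k)"] k' k_def by simp
  then have "\<psi> (n0 + int k') \<le> y \<and> y < \<psi> (n0 + int k' + 1)" using k k' by (simp add: algebra_simps)
  moreover have "m = n" if "\<psi> m \<le> y \<and> y < \<psi> (m + 1)" "\<psi> n \<le> y \<and> y < \<psi> (n + 1)" for m n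
  proof (rule ccontr)
    assume "m \<noteq> n"
    then have "m + 1 \<le> n \<or> n + 1 \<le> m" by linarith
    then show False using mono[of "m + 1" n] mono[of "n + 1" m] that by auto
  qed
  ultimately show ?thesis by blast
qed

text \<open>The translates by multiples of the first generator, with \<open>n\<close> fixed, fill the strip between two
  staircases, and strip \<open>n\<close> starts where strip \<open>n - 1\<close> ends.\<close>

lemma pythagorean_tiling_exact:
  fixes c s lam x y :: real
  assumes "c > 0" "s \<ge> 0" "lam > 0"
  shows "\<exists>!(j, m, n). (if j
      then 0 \<le> x - (of_int m * c + of_int n * lam * s) \<and> x - (of_int m * c + of_int n * lam * s) < c \<and>
           0 \<le> y - (of_int n * lam * c - of_int m * s) \<and> y - (of_int n * lam * c - of_int m * s) < lam * c
      else - (lam * s) \<le> x - (of_int m * c + of_int n * lam * s) \<and> x - (of_int m * c + of_int n * lam * s) < 0 \<and>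
           0 \<le> y - (of_int n * lam * c - of_int m * s) \<and> y - (of_int n * lam * c - of_int m * s) < s)"
proof -
  \<comment> \<open>\<open>M n\<close> is the index of the large rectangle in strip \<open>n\<close>
    whose horizontal range contains \<open>x\<close>, and \<open>\<psi> n\<close> is the height at
    which the strip starts there.\<close>
  define M where "M n = \<lfloor>(x - of_int n * lam * s) / c\<rfloor>" for n :: int
  define Y where "Y n = y - of_int n * lam * c" for n :: int
  define \<psi> where "\<psi> n = of_int n * lam * c - s * of_int (M (n - 1))" for n :: int
  \<comment> \<open>On the vertical line through \<open>x\<close>, strip \<open>n\<close> is a
    stack: from bottom to top the small rectangles \<open>M (n - 1)\<close> down to
    \<open>M n + 1\<close>, each of height \<open>s\<close>, then the large rectangle
    \<open>M n\<close>. \<open>A\<close> and \<open>B\<close> tell which of them contains the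
    point.\<close>
  define A where "A m n \<longleftrightarrow> m = M n \<and> - s * of_int m \<le> Y n \<and> Y n < lam * c - s * of_int m" for m n :: int
  define B where "B m n \<longleftrightarrow> M n < m \<and> m \<le> M (n - 1) \<and> - s * of_int m \<le> Y n \<and> Y n < s - s * of_int m" for m n :: int
  have M_le: "M n \<le> M (n - 1)" for n
    unfolding M_def using assms by (intro floor_mono divide_right_mono) (simp_all add: algebra_simps)
  have sM_le: "s * of_int m \<le> s * of_int m'" if "m \<le> m'" for m m' :: int
    using assms that by (intro mult_left_mono) auto
  have lc: "lam * c > 0" using assms by simp
  have A_iff: "(0 \<le> x - (of_int m * c + of_int n * lam * s) \<and> x - (of_int m * c + of_int n * lam * s) < c \<and>
           0 \<le> y - (of_int n * lam * c - of_int m * s) \<and> y - (of_int n * lam * c - of_int m * s) < lam * c)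
    \<longleftrightarrow> A m n" for m n
  proof -
    have "m = M n \<longleftrightarrow> of_int m \<le> (x - of_int n * lam * s) / c \<and> (x - of_int n * lam * s) / c < of_int m + 1"
      unfolding M_def by (auto simp: floor_unique[symmetric])
    also have "\<dots> \<longleftrightarrow> 0 \<le> x - (of_int m * c + of_int n * lam * s) \<and> x - (of_int m * c + of_int n * lam * s) < c"
      using assms(1) by (auto simp: pos_le_divide_eq pos_divide_less_eq algebra_simps)
    finally show ?thesis by (auto simp: A_def Y_def algebra_simps)
  qed
  have B_iff: "(- (lam * s) \<le> x - (of_int m * c + of_int n * lam * s) \<and> x - (of_int m * c + of_int n * lam * s) < 0 \<and>
           0 \<le> y - (of_int n * lam * c - of_int m * s) \<and> y - (of_int n * lam * c - of_int m * s) < s)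
    \<longleftrightarrow> B m n" for m n
  proof -
    have "M n < m \<longleftrightarrow> x - (of_int m * c + of_int n * lam * s) < 0"
      unfolding M_def floor_less_iff using assms(1) by (auto simp: pos_divide_less_eq algebra_simps)
    moreover have "m \<le> M (n - 1) \<longleftrightarrow> - (lam * s) \<le> x - (of_int m * c + of_int n * lam * s)"
      unfolding M_def le_floor_iff using assms(1) by (auto simp: pos_le_divide_eq algebra_simps)
    ultimately show ?thesis by (auto simp: B_def Y_def algebra_simps)
  qed
  have strip_iff: "\<psi> n \<le> y \<and> y < \<psi> (n + 1) \<longleftrightarrow> - s * of_int (M (n - 1)) \<le> Y n \<and> Y n < lam * c - s * of_int (M n)" for n
    by (auto simp: \<psi>_def Y_def algebra_simps)
  have "\<exists>!n. \<psi> n \<le> y \<and> y < \<psi> (n + 1)"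
  proof (rule unique_step[OF lc])
    fix n show "\<psi> n + lam * c \<le> \<psi> (n + 1)"
      using sM_le[OF M_le[of n]] by (simp add: \<psi>_def algebra_simps)
  qed
  then obtain n where n: "\<psi> n \<le> y \<and> y < \<psi> (n + 1)"
    and uniq: "\<And>n'. \<psi> n' \<le> y \<and> y < \<psi> (n' + 1) \<Longrightarrow> n' = n" by blast
  have A_strip: "n' = n" if "A m n'" for m n'
    using that sM_le[OF M_le[of n']] by (intro uniq) (auto simp: strip_iff A_def)
  have B_strip: "n' = n" if "B m n'" for m n'
  proof (rule uniq)
    have m: "M n' < m" "m \<le> M (n' - 1)" "- s * of_int m \<le> Y n'" "Y n' < s - s * of_int m"
      using that by (auto simp: B_def)
    have "s * of_int m \<le> s * of_int (M (n' - 1))" using m by (intro sM_le)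
    moreover have "s * of_int (M n') + s \<le> s * of_int m"
      using sM_le[of "M n' + 1" m] m(1) by (simp add: distrib_left)
    ultimately show "\<psi> n' \<le> y \<and> y < \<psi> (n' + 1)"
      unfolding strip_iff using m(3,4) lc by linarith
  qed
  have st: "- s * of_int (M (n - 1)) \<le> Y n" "Y n < lam * c - s * of_int (M n)" using n strip_iff by auto
  \<comment> \<open>The cases are whether or not the point reaches the bottom of the large
    rectangle.\<close>
  have "\<exists>!(j, m, n'). if j then A m n' else B m n'"
  proof (cases "- s * of_int (M n) \<le> Y n")
    case True
    have A: "A (M n) n" using True st by (simp add: A_def)
    have nB: "\<not> B m n" for m
    proof
      assume "B m n"
      moreover from this have "s * of_int (M n + 1) \<le> s * of_int m" by (intro sM_le) (simp add: B_def)
      ultimately show False using True by (simp add: B_def algebra_simps)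
    qed
    show ?thesis
    proof (rule ex1I[of _ "(True, M n, n)"])
      fix p assume p: "case p of (j, m, n') \<Rightarrow> if j then A m n' else B m n'"
      obtain j k n' where e: "p = (j, k, n')" by (cases p)
      show "p = (True, M n, n)"
      proof (cases j)
        case True
        then have a: "A k n'" using p e by simp
        then have "n' = n" by (rule A_strip)
        with a show ?thesis using True e by (simp add: A_def)
      next
        case False
        then have b: "B k n'" using p e by simp
        then have "n' = n" by (rule B_strip)
        with b show ?thesis using nB by simp
      qed
    qed (use A in simp)
  next
    case False
    \<comment> \<open>Room below the large rectangle requires a step of the staircase, hence
      \<open>s > 0\<close>, and division by \<open>s\<close> finds the small rectangle.\<close>
    then have lt: "s * of_int (M n) < s * of_int (M (n - 1))" using st by simp
    then have s: "s > 0" using assms(2) by (cases "s = 0") auto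
    define m where "m = \<lceil>- Y n / s\<rceil>"
    have m_iff: "- s * of_int m' \<le> Y n \<and> Y n < s - s * of_int m' \<longleftrightarrow> m' = m" for m' :: int
    proof -
      have "m' = m \<longleftrightarrow> of_int m' - 1 < - Y n / s \<and> - Y n / s \<le> of_int m'"
        unfolding m_def by (metis ceiling_correct ceiling_unique)
      also have "\<dots> \<longleftrightarrow> - s * of_int m' \<le> Y n \<and> Y n < s - s * of_int m'"
        unfolding pos_less_divide_eq[OF s] pos_divide_le_eq[OF s] by (auto simp: algebra_simps)
      finally show ?thesis by blast
    qed
    have "m \<le> M (n - 1)" unfolding m_def ceiling_le_iff pos_divide_le_eq[OF s] using st by (simp add: algebra_simps)
    moreover have "M n < m" unfolding m_def less_ceiling_iff pos_less_divide_eq[OF s] using False by (simp add: algebra_simps)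
    ultimately have B: "B m n" using m_iff[of m] by (simp add: B_def)
    have B_unique: "m' = m" if "B m' n" for m' using that m_iff[of m'] by (simp add: B_def)
    have nA: "\<not> A m' n" for m' using False by (auto simp: A_def)
    show ?thesis
    proof (rule ex1I[of _ "(False, m, n)"])
      fix p assume p: "case p of (j, m, n') \<Rightarrow> if j then A m n' else B m n'"
      obtain j k n' where e: "p = (j, k, n')" by (cases p)
      show "p = (False, m, n)"
      proof (cases j)
        case True
        then have a: "A k n'" using p e by simp
        then have "n' = n" by (rule A_strip)
        with a show ?thesis using nA by simp
      next
        case False
        then have b: "B k n'" using p e by simp
        then have "n' = n" by (rule B_strip)
        with b show ?thesis using False e B_unique by simp
      qed
    qed (use B in simp)
  qed
  then show ?thesis unfolding A_iff B_iff .
qed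

section \<open>Comparing two tilings with the same lattice\<close>

lemma lattice_tilings_equal_mass:
  fixes a b c d :: "'i \<Rightarrow> real" and a' b' c' d' :: "'j \<Rightarrow> real"
    and tx ty :: "'k::ab_group_add \<Rightarrow> real"
  assumes fin: "finite I" "finite J" and add: "Modules.additive f" "Modules.additive g"
    and neg: "\<And>k. tx (- k) = - tx k" "\<And>k. ty (- k) = - ty k"
    and discrete: "\<And>M. finite {k. \<bar>tx k\<bar> \<le> M \<and> \<bar>ty k\<bar> \<le> M}"
    and ex1: "exact_cover I a b c d tx ty" and ex2: "exact_cover J a' b' c' d' tx ty"
  shows "(\<Sum>i\<in>I. mass f (a i) (b i) * mass g (c i) (d i)) =
    (\<Sum>j\<in>J. mass f (a' j) (b' j) * mass g (c' j) (d' j))"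
proof -
  define R where "R i x y \<longleftrightarrow> i \<in> I \<and> a i \<le> x \<and> x < b i \<and> c i \<le> y \<and> y < d i" for i x y
  define Q where "Q j x y \<longleftrightarrow> j \<in> J \<and> a' j \<le> x \<and> x < b' j \<and> c' j \<le> y \<and> y < d' j" for j x y
  \<comment> \<open>Only translations that make a tile of \<open>I\<close> meet a shifted tile of
    \<open>J\<close> matter. An overlap bounds both components by the crude constant
    \<open>W\<close>, so discreteness makes \<open>K\<close> finite and the double counting
    applies.\<close>
  define K where "K = {k. \<exists>i j x y. R i x y \<and> Q j (x - tx k) (y - ty k)}"
  define W where "W = (\<Sum>i\<in>I. \<bar>a i\<bar> + \<bar>b i\<bar> + \<bar>c i\<bar> + \<bar>d i\<bar>) + (\<Sum>j\<in>J. \<bar>a' j\<bar> + \<bar>b' j\<bar> + \<bar>c' j\<bar> + \<bar>d' j\<bar>)"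
  have "K \<subseteq> {k. \<bar>tx k\<bar> \<le> W \<and> \<bar>ty k\<bar> \<le> W}"
  proof
    fix k assume "k \<in> K"
    then obtain i j x y where R: "R i x y" and Q: "Q j (x - tx k) (y - ty k)" by (auto simp: K_def)
    have "\<bar>a i\<bar> + \<bar>b i\<bar> + \<bar>c i\<bar> + \<bar>d i\<bar> \<le> (\<Sum>i\<in>I. \<bar>a i\<bar> + \<bar>b i\<bar> + \<bar>c i\<bar> + \<bar>d i\<bar>)"
      using R fin by (intro member_le_sum) (auto simp: R_def)
    moreover have "\<bar>a' j\<bar> + \<bar>b' j\<bar> + \<bar>c' j\<bar> + \<bar>d' j\<bar> \<le> (\<Sum>j\<in>J. \<bar>a' j\<bar> + \<bar>b' j\<bar> + \<bar>c' j\<bar> + \<bar>d' j\<bar>)"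
      using Q fin by (intro member_le_sum) (auto simp: Q_def)
    moreover have "\<bar>tx k\<bar> \<le> \<bar>a i\<bar> + \<bar>b i\<bar> + (\<bar>a' j\<bar> + \<bar>b' j\<bar>)" "\<bar>ty k\<bar> \<le> \<bar>c i\<bar> + \<bar>d i\<bar> + (\<bar>c' j\<bar> + \<bar>d' j\<bar>)"
      using R Q by (auto simp: R_def Q_def)
    moreover have "t \<le> S + T \<and> u \<le> S + T"
      if "p1 + p2 + p3 + p4 \<le> S" "q1 + q2 + q3 + q4 \<le> T" "t \<le> p1 + p2 + (q1 + q2)" "u \<le> p3 + p4 + (q3 + q4)"
        "0 \<le> p1" "0 \<le> p2" "0 \<le> p3" "0 \<le> p4" "0 \<le> q1" "0 \<le> q2" "0 \<le> q3" "0 \<le> q4"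
      for p1 p2 p3 p4 q1 q2 q3 q4 S T t u :: real
      using that by linarith
    ultimately have "\<bar>tx k\<bar> \<le> W \<and> \<bar>ty k\<bar> \<le> W" unfolding W_def using abs_ge_zero by blast
    then show "k \<in> {k. \<bar>tx k\<bar> \<le> W \<and> \<bar>ty k\<bar> \<le> W}" by simp
  qed
  then have K: "finite K" using discrete finite_subset by blast
  show ?thesis
  proof (rule mass_prod_sum_eq[OF fin K add])
    fix i x y assume "i \<in> I" "a i \<le> x" "x < b i" "c i \<le> y" "y < d i"
    then have R: "R i x y" by (simp add: R_def)
    obtain l where l: "Q (fst l) (x - tx (snd l)) (y - ty (snd l))"
      and u: "\<And>l'. Q (fst l') (x - tx (snd l')) (y - ty (snd l')) \<Longrightarrow> l' = l"
      using ex2[unfolded exact_cover_def, rule_format, of x y] unfolding Q_def by (auto simp: mem_Times_iff)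
    have "snd l \<in> K" unfolding K_def using R l by blast
    then show "\<exists>!l. l \<in> J \<times> K \<and> a' (fst l) \<le> x - tx (snd l) \<and> x - tx (snd l) < b' (fst l) \<and>
        c' (fst l) \<le> y - ty (snd l) \<and> y - ty (snd l) < d' (fst l)"
    proof (intro ex1I[of _ l])
      fix l' assume "l' \<in> J \<times> K \<and> a' (fst l') \<le> x - tx (snd l') \<and> x - tx (snd l') < b' (fst l') \<and>
        c' (fst l') \<le> y - ty (snd l') \<and> y - ty (snd l') < d' (fst l')"
      then show "l' = l" by (intro u) (auto simp: Q_def)
    qed (use l in \<open>simp add: Q_def mem_Times_iff\<close>)
  next
    fix j x y assume "j \<in> J" "a' j \<le> x" "x < b' j" "c' j \<le> y" "y < d' j"
    then have Q: "Q j x y" by (simp add: Q_def)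
    obtain l where l: "R (fst l) (x - tx (snd l)) (y - ty (snd l))"
      and u: "\<And>l'. R (fst l') (x - tx (snd l')) (y - ty (snd l')) \<Longrightarrow> l' = l"
      using ex1[unfolded exact_cover_def, rule_format, of x y] unfolding R_def by (auto simp: mem_Times_iff)
    \<comment> \<open>The goal shifts points by \<open>+ tx\<close> but the cover by
      \<open>I\<close> uses \<open>- tx\<close>, so the translation is negated.\<close>
    let ?l = "(fst l, - snd l)"
    have lK: "- snd l \<in> K"
    proof -
      have "R (fst l) (x - tx (snd l)) (y - ty (snd l)) \<and>
        Q j (x - tx (snd l) - tx (- snd l)) (y - ty (snd l) - ty (- snd l))"
        using l Q by (simp add: neg)
      then show ?thesis unfolding K_def by blast
    qed
    show "\<exists>!l. l \<in> I \<times> K \<and> a (fst l) \<le> x + tx (snd l) \<and> x + tx (snd l) < b (fst l) \<and>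
        c (fst l) \<le> y + ty (snd l) \<and> y + ty (snd l) < d (fst l)"
    proof (rule ex1I[of _ ?l])
      show "?l \<in> I \<times> K \<and> a (fst ?l) \<le> x + tx (snd ?l) \<and> x + tx (snd ?l) < b (fst ?l) \<and>
        c (fst ?l) \<le> y + ty (snd ?l) \<and> y + ty (snd ?l) < d (fst ?l)"
        using l lK by (simp add: R_def neg)
    next
      fix l' assume "l' \<in> I \<times> K \<and> a (fst l') \<le> x + tx (snd l') \<and> x + tx (snd l') < b (fst l') \<and>
        c (fst l') \<le> y + ty (snd l') \<and> y + ty (snd l') < d (fst l')"
      then have "(fst l', - snd l') = l" by (intro u) (auto simp: R_def neg)
      then have "fst l' = fst l" "snd l = - snd l'" by auto
      then show "l' = ?l" by (simp add: prod_eq_iff)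
    qed
  qed
qed

section \<open>Rational linear functionals\<close>

interpretation rat_real: vector_space "\<lambda>(q::rat) (x::real). of_rat q * x"
  by unfold_locales (auto simp: algebra_simps of_rat_add of_rat_mult)

interpretation rat_real_pair: vector_space_pair
  "\<lambda>(q::rat) (x::real). of_rat q * x" "\<lambda>(q::rat) (x::real). of_rat q * x" ..

abbreviation rat_linear :: "(real \<Rightarrow> real) \<Rightarrow> bool" where
  "rat_linear \<equiv> Vector_Spaces.linear (\<lambda>(q::rat) (x::real). of_rat q * x) (\<lambda>q x. of_rat q * x)"

lemma rat_linear_add: "rat_linear f \<Longrightarrow> f (x + y) = f x + f y"
  by (rule rat_real_pair.linear_add)

lemma rat_linear_imp_additive: "rat_linear f \<Longrightarrow> Modules.additive f"
  by (simp add: Modules.additive.intro rat_linear_add)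

lemma rat_linear_scale: "rat_linear f \<Longrightarrow> f (of_rat q * x) = of_rat q * f x"
  by (rule rat_real_pair.linear_scale)

lemma rat_linear_combination:
  "rat_linear f \<Longrightarrow> f (of_rat p * x + of_rat q * y) = of_rat p * f x + of_rat q * f y"
  by (simp add: rat_linear_add rat_linear_scale)

text \<open>Extension to a Hamel basis allows values to be prescribed on an independent set; all
  test functionals below arise this way.\<close>

lemma rat_linear_extend:
  assumes "rat_real.independent B"
  obtains f where "rat_linear f" "\<And>x. x \<in> B \<Longrightarrow> f x = (\<phi> x :: real)"
  using rat_real_pair.linear_independent_extend[OF assms, of \<phi>] by blast

lemma rat_real_span_pair:
  "x \<in> rat_real.span {y, z} \<longleftrightarrow> (\<exists>p q. x = of_rat p * y + of_rat q * z)"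
proof -
  have "x \<in> rat_real.span {y, z} \<longleftrightarrow> (\<exists>p q. x - of_rat p * y = of_rat q * z)"
    by (auto simp: rat_real.span_insert[of y] rat_real.span_singleton)
  also have "\<dots> \<longleftrightarrow> (\<exists>p q. x = of_rat p * y + of_rat q * z)"
    by (simp add: diff_eq_eq add.commute)
  finally show ?thesis .
qed

lemma rat_real_independent_pair:
  assumes "c \<noteq> 0" "lam \<notin> \<rat>"
  shows "rat_real.independent {c, lam * c}" "lam * c \<noteq> c"
proof -
  have "lam \<noteq> 1" using assms by auto
  then show ne: "lam * c \<noteq> c" using assms by auto
  have "lam * c \<notin> rat_real.span {c}"
    using assms by (auto simp: rat_real.span_singleton Rats_def)
  then have "rat_real.independent {lam * c, c}"
    using assms ne by (simp add: rat_real.independent_insert)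
  then show "rat_real.independent {c, lam * c}" by (simp add: insert_commute)
qed

section \<open>Semidefinite forms and quadratic irrationals\<close>

lemma quadratic_form_nonneg_imp_discriminant:
  fixes a b d :: real
  assumes "\<And>x y. 0 \<le> a * x\<^sup>2 + 2 * b * x * y + d * y\<^sup>2"
  shows "b\<^sup>2 \<le> a * d"
proof (cases "a = 0")
  case True
  have "b = 0"
  proof (rule ccontr)
    assume "b \<noteq> 0"
    \<comment> \<open>With \<open>a = 0\<close> the form equals -1 at this point.\<close>
    then show False using assms[of "- (d + 1) / (2 * b)" 1] True by (simp add: field_simps)
  qed
  then show ?thesis using True by simp
next
  case False
  have "a \<ge> 0" using assms[of 1 0] by simp
  then have "a > 0" using False by simp
  have "0 \<le> a * (a * d - b\<^sup>2)"
    using assms[of b "-a"] by (simp add: power2_eq_square algebra_simps)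
  then show ?thesis using \<open>a > 0\<close> by (simp add: zero_le_mult_iff)
qed

text \<open>Symmetry puts \<open>s\<close> and \<open>lam * s\<close> into the rational span of
  \<open>c\<close> and \<open>lam * c\<close>. Eliminating \<open>s\<close> from the two expressions
  gives the quadratic equation, and semidefiniteness gives the sign of \<open>N\<close>.\<close>

lemma symmetric_form_imp_quadratic:
  fixes lam c s :: real
  assumes "c > 0" "lam > 0" and irr: "lam \<notin> \<rat>"
    and sym: "\<And>f g. rat_linear f \<Longrightarrow> rat_linear g \<Longrightarrow>
      f c * g (lam * c) + f (lam * s) * g s = g c * f (lam * c) + g (lam * s) * f s"
    and pos: "\<And>f. rat_linear f \<Longrightarrow> 0 \<le> f c * f (lam * c) + f (lam * s) * f s"
  shows "\<exists>P\<in>\<rat>. \<exists>N\<in>\<rat>. N > 0 \<and> lam\<^sup>2 - 2 * P * lam + N = 0"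
proof -
  let ?V = "rat_real.span {c, lam * c}"
  note ind = rat_real_independent_pair[OF _ irr]
  have ic: "rat_real.independent {c, lam * c}" "lam * c \<noteq> c" using ind[of c] \<open>c > 0\<close> by auto
  have s_in: "s \<in> ?V"
  proof (rule ccontr)
    assume n: "s \<notin> ?V"
    then have s0: "s \<noteq> 0" using rat_real.span_zero by auto
    have nn: "s \<notin> {c, lam * c}" using n rat_real.span_base[of s "{c, lam * c}"] by argo
    have i3: "rat_real.independent {s, c, lam * c}"
      using ic n nn by (subst rat_real.independent_insert) auto
    \<comment> \<open>\<open>g\<close> vanishes on \<open>c\<close> and \<open>lam * c\<close> and
      is 1 on \<open>s\<close>; \<open>f\<close> is 0 on \<open>s\<close> and 1 on
      \<open>lam * s\<close>. Symmetry then reads \<open>1 = 0\<close>.\<close>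
    from rat_linear_extend[OF i3, of "\<lambda>x. if x = s then 1 else 0"] obtain g where
      g: "rat_linear g" "\<And>x. x \<in> {s, c, lam * c} \<Longrightarrow> g x = (if x = s then 1 else 0)" by auto
    from rat_linear_extend[OF ind(1)[OF s0], of "\<lambda>x. if x = s then 0 else 1"] obtain f where
      f: "rat_linear f" "\<And>x. x \<in> {s, lam * s} \<Longrightarrow> f x = (if x = s then 0 else 1)" by auto
    show False using sym[OF f(1) g(1)] f(2)[of s] f(2)[of "lam * s"] g(2)[of s] g(2)[of c]
        g(2)[of "lam * c"] nn ind(2)[OF s0] by auto
  qed
  have ls_in: "lam * s \<in> ?V"
  proof (rule ccontr)
    assume n: "lam * s \<notin> ?V"
    then have s0: "s \<noteq> 0" using rat_real.span_zero by auto
    have nn: "lam * s \<notin> {c, lam * c}" using n rat_real.span_base[of "lam * s" "{c, lam * c}"] by argo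
    have i3: "rat_real.independent {lam * s, c, lam * c}"
      using ic n nn by (subst rat_real.independent_insert) auto
    \<comment> \<open>Now \<open>g\<close> is 1 on \<open>lam * s\<close> and vanishes on
      \<open>s\<close>, which already lies in the span; with \<open>f\<close> equal to 1 on
      \<open>s\<close> and 0 on \<open>lam * s\<close>, symmetry reads \<open>0 = 1\<close>.\<close>
    from rat_linear_extend[OF i3, of "\<lambda>x. if x = lam * s then 1 else 0"] obtain g where
      g: "rat_linear g" "\<And>x. x \<in> {lam * s, c, lam * c} \<Longrightarrow> g x = (if x = lam * s then 1 else 0)" by auto
    from rat_linear_extend[OF ind(1)[OF s0], of "\<lambda>x. if x = s then 1 else 0"] obtain f where
      f: "rat_linear f" "\<And>x. x \<in> {s, lam * s} \<Longrightarrow> f x = (if x = s then 1 else 0)" by auto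
    obtain p q where pq: "s = of_rat p * c + of_rat q * (lam * c)"
      using s_in rat_real_span_pair by auto
    have "g s = of_rat p * g c + of_rat q * g (lam * c)"
      unfolding pq by (rule rat_linear_combination[OF g(1)])
    then have "g s = 0" using g(2)[of c] g(2)[of "lam * c"] nn by auto
    then show False using sym[OF f(1) g(1)] f(2)[of s] f(2)[of "lam * s"] g(2)[of "lam * s"] g(2)[of c]
        g(2)[of "lam * c"] nn ind(2)[OF s0] by auto
  qed
  obtain \<alpha> \<beta> where s_eq: "s = of_rat \<alpha> * c + of_rat \<beta> * (lam * c)"
    using s_in rat_real_span_pair by auto
  obtain \<gamma> \<delta> where ls_eq: "lam * s = of_rat \<gamma> * c + of_rat \<delta> * (lam * c)"
    using ls_in rat_real_span_pair by auto
  define a b d e where "a = (of_rat \<alpha> :: real)" and "b = (of_rat \<beta> :: real)"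
    and "d = (of_rat \<gamma> :: real)" and "e = (of_rat \<delta> :: real)"
  note defs = a_def b_def d_def e_def
  have rats: "a \<in> \<rat>" "b \<in> \<rat>" "d \<in> \<rat>" "e \<in> \<rat>" by (simp_all add: defs)
  have ex: "\<exists>f. rat_linear f \<and> f c = x \<and> f (lam * c) = y \<and> f s = a * x + b * y
      \<and> f (lam * s) = d * x + e * y" for x y
  proof -
    from rat_linear_extend[OF ic(1), of "\<lambda>z. if z = c then x else y"] obtain f where
      f: "rat_linear f" "\<And>z. z \<in> {c, lam * c} \<Longrightarrow> f z = (if z = c then x else y)" by auto
    have "f s = a * f c + b * f (lam * c)"
      by (subst s_eq) (simp add: rat_linear_combination[OF f(1)] defs)
    moreover have "f (lam * s) = d * f c + e * f (lam * c)"
      by (subst ls_eq) (simp add: rat_linear_combination[OF f(1)] defs)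
    ultimately show ?thesis using f ic(2) by (intro exI[of _ f]) auto
  qed
  \<comment> \<open>Symmetry is tested on functionals dual to \<open>c\<close> and
    \<open>lam * c\<close>.\<close>
  have det: "1 + d * b = e * a"
  proof -
    obtain f where f: "rat_linear f" "f c = 1" "f (lam * c) = 0" "f s = a" "f (lam * s) = d"
      using ex[of 1 0] by auto
    obtain g where g: "rat_linear g" "g c = 0" "g (lam * c) = 1" "g s = b" "g (lam * s) = e"
      using ex[of 0 1] by auto
    show ?thesis using sym[OF f(1) g(1)] f g by simp
  qed
  have "0 \<le> a * d * x\<^sup>2 + 2 * (1 + b * d) * x * y + b * e * y\<^sup>2" for x y
  proof -
    obtain f where f: "rat_linear f" "f c = x" "f (lam * c) = y" "f s = a * x + b * y"
      "f (lam * s) = d * x + e * y" using ex[of x y] by auto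
    have "0 \<le> x * y + (d * x + e * y) * (a * x + b * y)" using pos[OF f(1)] f by simp
    also have "\<dots> = a * d * x\<^sup>2 + (1 + e * a + b * d) * x * y + b * e * y\<^sup>2"
      by (simp add: power2_eq_square algebra_simps)
    also have "\<dots> = a * d * x\<^sup>2 + 2 * (1 + b * d) * x * y + b * e * y\<^sup>2"
      unfolding det[symmetric] by (simp add: algebra_simps)
    finally show ?thesis .
  qed
  \<comment> \<open>By \<open>det\<close> the right-hand side is \<open>b * d * (1 + b * d)\<close>,
    so the inequality amounts to \<open>1 + b * d \<le> 0\<close>.\<close>
  then have "(1 + b * d)\<^sup>2 \<le> a * d * (b * e)"
    by (rule quadratic_form_nonneg_imp_discriminant)
  also have "\<dots> = (b * d) * (1 + d * b)" unfolding det by simp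
  finally have "b * d < 0" by (simp add: power2_eq_square algebra_simps)
  then have b0: "b \<noteq> 0" by auto
  have "c * (lam * (a + b * lam)) = c * (d + e * lam)"
    using s_eq ls_eq by (simp add: defs algebra_simps)
  then have "lam * (a + b * lam) = d + e * lam" using \<open>c > 0\<close> by simp
  \<comment> \<open>Division by \<open>b\<close> gives a monic equation whose roots have product
    \<open>- d / b\<close>, positive because \<open>b * d < 0\<close>.\<close>
  moreover have "b * (lam\<^sup>2 - 2 * ((e - a) / (2 * b)) * lam + (- d / b))
      = lam * (a + b * lam) - (d + e * lam)"
  proof -
    have "b * (2 * ((e - a) / (2 * b)) * lam) = (e - a) * lam" "b * (- d / b) = - d"
      using b0 by auto
    then show ?thesis by (simp add: power2_eq_square algebra_simps)
  qed
  ultimately have "b * (lam\<^sup>2 - 2 * ((e - a) / (2 * b)) * lam + (- d / b)) = 0" by simp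
  then have "lam\<^sup>2 - 2 * ((e - a) / (2 * b)) * lam + (- d / b) = 0" using b0 by auto
  moreover have "- d / b > 0" using \<open>b * d < 0\<close> by (auto simp: mult_less_0_iff divide_less_0_iff)
  moreover have "(e - a) / (2 * b) \<in> \<rat>" "- d / b \<in> \<rat>" using rats by auto
  ultimately show ?thesis by blast
qed

text \<open>With \<open>D = P^2 - N\<close>, the task is to factor
  \<open>D = (q - r) * (q + r)\<close> with rational \<open>q \<le> P\<close>. For
  \<open>w = q - r\<close> this bound reads \<open>(P - w)^2 \<le> N\<close>, so a rational
  \<open>w\<close> between \<open>P - sqrt N\<close> and \<open>sqrt D\<close> serves.\<close>

lemma quadratic_imp_sqrt_form:
  fixes lam P N :: real
  assumes "lam > 0" "P \<in> \<rat>" "N \<in> \<rat>" "N > 0" and quad: "lam\<^sup>2 - 2 * P * lam + N = 0"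
  shows "\<exists>p \<in> \<rat>. \<exists>q \<in> \<rat>. \<exists>r \<in> \<rat>. p \<ge> q \<and> q \<ge> r \<and> r \<ge> 0 \<and>
           (lam = p + sqrt (q\<^sup>2 - r\<^sup>2) \<or> lam = p - sqrt (q\<^sup>2 - r\<^sup>2))"
proof (cases "lam = P")
  case True
  then show ?thesis using assms by (intro bexI[of _ P] bexI[of _ 0]) auto
next
  case False
  define D where "D = P\<^sup>2 - N"
  have D_eq: "D = (lam - P)\<^sup>2" using quad by (simp add: D_def power2_eq_square algebra_simps)
  have "D > 0" using False by (simp add: D_eq)
  have "D \<in> \<rat>" using assms by (simp add: D_def)
  have "2 * P * lam > 0" using quad \<open>N > 0\<close> zero_le_power2[of lam] by linarith
  then have "P > 0" using \<open>lam > 0\<close> by (simp add: zero_less_mult_iff)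
  define t where "t = sqrt D"
  have t: "t > 0" "t\<^sup>2 = D" using \<open>D > 0\<close> by (auto simp: t_def)
  have "t < P" using \<open>N > 0\<close> \<open>P > 0\<close> t by (intro power2_less_imp_less[of t P]) (auto simp: D_def)
  define n where "n = sqrt N"
  have n: "n > 0" "n\<^sup>2 = N" using \<open>N > 0\<close> by (auto simp: n_def)
  have "n < P" using \<open>D > 0\<close> \<open>P > 0\<close> n by (intro power2_less_imp_less[of n P]) (auto simp: D_def)
  \<comment> \<open>This makes the interval for \<open>w\<close> nonempty; since
    \<open>n^2 = P^2 - t^2\<close>, it follows from \<open>t < P\<close>.\<close>
  have "(P - t)\<^sup>2 < n\<^sup>2"
  proof -
    have "t\<^sup>2 < P * t" unfolding power2_eq_square using \<open>t < P\<close> t by simp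
    then show ?thesis using t n by (simp add: D_def power2_diff)
  qed
  then have "P - t < n" using n by (auto intro: power2_less_imp_less)
  then obtain w where w: "w \<in> \<rat>" "P - n < w" "w < t" using Rats_dense_in_real[of "P - n" t] by auto
  have "w > 0" using w \<open>n < P\<close> by simp
  have "w\<^sup>2 \<le> D" using w \<open>w > 0\<close> t by (metis less_imp_le power2_less_eq_zero_iff power_mono)
  have "(P - w)\<^sup>2 \<le> n\<^sup>2" using w \<open>t < P\<close> by (intro power_mono) auto
  then have "w\<^sup>2 + D \<le> 2 * P * w" using n by (simp add: D_def power2_eq_square algebra_simps)
  \<comment> \<open>\<open>q - r = w\<close> and \<open>q + r = D / w\<close>; for \<open>w\<close> close to \<open>sqrt D < P\<close> this gives \<open>q \<le> P\<close>\<close>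
  define q r where "q = (w + D / w) / 2" and "r = (D / w - w) / 2"
  have "q \<in> \<rat>" "r \<in> \<rat>" using w \<open>D \<in> \<rat>\<close> by (auto simp: q_def r_def)
  moreover have "q \<le> P" using \<open>w\<^sup>2 + D \<le> 2 * P * w\<close> \<open>w > 0\<close>
    by (simp add: q_def field_simps power2_eq_square)
  moreover have "r \<le> q" using \<open>w > 0\<close> by (simp add: q_def r_def)
  moreover have "r \<ge> 0" using \<open>w > 0\<close> \<open>w\<^sup>2 \<le> D\<close> by (simp add: r_def field_simps power2_eq_square)
  moreover have "q\<^sup>2 - r\<^sup>2 = D"
    using \<open>w > 0\<close> by (simp add: q_def r_def power2_eq_square field_simps)
  then have "sqrt (q\<^sup>2 - r\<^sup>2) = \<bar>lam - P\<bar>" by (simp add: D_eq)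
  then have "lam = P + sqrt (q\<^sup>2 - r\<^sup>2) \<or> lam = P - sqrt (q\<^sup>2 - r\<^sup>2)" by linarith
  ultimately show ?thesis using \<open>P \<in> \<rat>\<close> by blast
qed

section \<open>Dissection identity and conclusion\<close>

lemma mass_additive:
  assumes "Modules.additive f" "a \<le> b"
  shows "mass f a b = f (b - a)"
  using assms by (auto simp: mass_def Modules.additive.diff)

text \<open>The squares and the pair of rectangles cover the plane exactly under the same rotated
  lattice, so their additive areas agree.\<close>

lemma tiling_sum_identity:
  fixes lam c s :: real and a b h :: "(real \<times> real) set \<Rightarrow> real" and f g :: "real \<Rightarrow> real"
  assumes "lam > 0" "finite \<Gamma>" "c > 0" "s \<ge> 0" and cs: "c\<^sup>2 + s\<^sup>2 = 1"
    and h: "\<And>S. S \<in> \<Gamma> \<Longrightarrow> h S > 0"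
    and exact: "exact_cover \<Gamma> a (\<lambda>S. a S + h S) b (\<lambda>S. b S + h S)
       (\<lambda>k. c * fst (lattice_point lam k) + s * snd (lattice_point lam k))
       (\<lambda>k. c * snd (lattice_point lam k) - s * fst (lattice_point lam k))"
    and add: "Modules.additive f" "Modules.additive g"
  shows "(\<Sum>S\<in>\<Gamma>. f (h S) * g (h S)) = f c * g (lam * c) + f (lam * s) * g s"
proof -
  define tx ty where "tx k = c * fst (lattice_point lam k) + s * snd (lattice_point lam k)"
    and "ty k = c * snd (lattice_point lam k) - s * fst (lattice_point lam k)" for k
  have norm_t: "(tx k)\<^sup>2 + (ty k)\<^sup>2 = (norm (lattice_point lam k))\<^sup>2" for k
  proof -
    have "(tx k)\<^sup>2 + (ty k)\<^sup>2 = (c\<^sup>2 + s\<^sup>2) * ((fst (lattice_point lam k))\<^sup>2 + (snd (lattice_point lam k))\<^sup>2)"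
      by (simp add: tx_def ty_def power2_eq_square algebra_simps)
    then show ?thesis using cs by (simp add: norm_prod_def)
  qed
  \<comment> \<open>\<open>True\<close> is the large rectangle with its corner at the origin,
    \<open>False\<close> the small one to its left.\<close>
  let ?a = "\<lambda>j. if j then 0 else - (lam * s)" and ?b = "\<lambda>j. if j then c else 0"
    and ?d = "\<lambda>j. if j then lam * c else s"
  have "(\<Sum>S\<in>\<Gamma>. mass f (a S) (a S + h S) * mass g (b S) (b S + h S)) =
    (\<Sum>j\<in>UNIV. mass f (?a j) (?b j) * mass g 0 (?d j))"
  proof (rule lattice_tilings_equal_mass[where tx = tx and ty = ty])
    fix k show "tx (- k) = - tx k" "ty (- k) = - ty k"
      by (simp_all add: tx_def ty_def lattice_point_minus)
  next
    fix M
    \<comment> \<open>Rotation preserves norms, so bounded components leave finitely many lattice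
      points.\<close>
    have norm_le: "norm (lattice_point lam k) \<le> \<bar>tx k\<bar> + \<bar>ty k\<bar>" for k
    proof (rule power2_le_imp_le)
      show "(norm (lattice_point lam k))\<^sup>2 \<le> (\<bar>tx k\<bar> + \<bar>ty k\<bar>)\<^sup>2"
        unfolding norm_t[symmetric] by (simp add: power2_sum)
    qed simp
    have "{k. \<bar>tx k\<bar> \<le> M \<and> \<bar>ty k\<bar> \<le> M} \<subseteq> {k. norm (lattice_point lam k) \<le> M + M}"
      by (intro Collect_mono impI order_trans[OF norm_le] add_mono) simp_all
    then show "finite {k. \<bar>tx k\<bar> \<le> M \<and> \<bar>ty k\<bar> \<le> M}"
      using finite_lattice_points_bounded[OF \<open>lam > 0\<close>] by (rule finite_subset)
  next
    show "exact_cover \<Gamma> a (\<lambda>S. a S + h S) b (\<lambda>S. b S + h S) tx ty"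
      using exact unfolding tx_def ty_def .
  next
    show "exact_cover UNIV ?a ?b (\<lambda>_. 0) ?d tx ty"
      unfolding exact_cover_def
    proof (intro allI)
      fix x y
      have "(\<exists>!l. l \<in> UNIV \<times> UNIV \<and> ?a (fst l) \<le> x - tx (snd l) \<and> x - tx (snd l) < ?b (fst l) \<and>
          0 \<le> y - ty (snd l) \<and> y - ty (snd l) < ?d (fst l)) \<longleftrightarrow>
        (\<exists>!(j, m, n). (if j
        then 0 \<le> x - (of_int m * c + of_int n * lam * s) \<and> x - (of_int m * c + of_int n * lam * s) < c \<and>
             0 \<le> y - (of_int n * lam * c - of_int m * s) \<and> y - (of_int n * lam * c - of_int m * s) < lam * c
        else - (lam * s) \<le> x - (of_int m * c + of_int n * lam * s) \<and> x - (of_int m * c + of_int n * lam * s) < 0 \<and>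
             0 \<le> y - (of_int n * lam * c - of_int m * s) \<and> y - (of_int n * lam * c - of_int m * s) < s))"
        by (rule arg_cong[where f = Ex1], rule ext)
          (auto simp: tx_def ty_def lattice_point_def mult.commute mult.left_commute)
      then show "\<exists>!l. l \<in> UNIV \<times> UNIV \<and> ?a (fst l) \<le> x - tx (snd l) \<and> x - tx (snd l) < ?b (fst l) \<and>
          0 \<le> y - ty (snd l) \<and> y - ty (snd l) < ?d (fst l)"
        using pythagorean_tiling_exact[OF \<open>c > 0\<close> \<open>s \<ge> 0\<close> \<open>lam > 0\<close>, of x y] by blast
    qed
  qed (use assms in auto)
  moreover have "(\<Sum>S\<in>\<Gamma>. mass f (a S) (a S + h S) * mass g (b S) (b S + h S)) = (\<Sum>S\<in>\<Gamma>. f (h S) * g (h S))"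
    using h by (intro sum.cong) (auto simp: mass_additive add less_imp_le)
  moreover have "(\<Sum>j\<in>UNIV. mass f (?a j) (?b j) * mass g 0 (?d j)) = f c * g (lam * c) + f (lam * s) * g s"
    using assms(1,3,4) by (simp add: UNIV_bool mass_additive add)
  ultimately show ?thesis by simp
qed

theorem theorem1:
  fixes lam :: real
  assumes "lam > 0"
    and "\<exists>\<Gamma>. periodic_square_tiling lam \<Gamma>"
  shows "\<exists>p \<in> \<rat>. \<exists>q \<in> \<rat>. \<exists>r \<in> \<rat>. p \<ge> q \<and> q \<ge> r \<and> r \<ge> 0 \<and>
           (lam = p + sqrt (q\<^sup>2 - r\<^sup>2) \<or> lam = p - sqrt (q\<^sup>2 - r\<^sup>2))"
proof (cases "lam \<in> \<rat>")
  case True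
  \<comment> \<open>A rational \<open>lam\<close> is represented by \<open>p = lam\<close> and
    \<open>q = r = 0\<close>.\<close>
  then show ?thesis using assms(1) by (intro bexI[of _ lam] bexI[of _ 0]) auto
next
  case False
  obtain \<Gamma> where tiling: "periodic_square_tiling lam \<Gamma>" using assms(2) by blast
  then have fin: "finite \<Gamma>" by (simp add: periodic_square_tiling_def)
  obtain c s a b h where tile: "c > 0" "s \<ge> 0" "c\<^sup>2 + s\<^sup>2 = 1" "\<And>S. S \<in> \<Gamma> \<Longrightarrow> h S > 0"
    "exact_cover \<Gamma> a (\<lambda>S. a S + h S) b (\<lambda>S. b S + h S)
       (\<lambda>k. c * fst (lattice_point lam k) + s * snd (lattice_point lam k))
       (\<lambda>k. c * snd (lattice_point lam k) - s * fst (lattice_point lam k))"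
    by (rule tiling_half_open[OF assms(1) tiling]) (rule that; assumption)
  have identity: "f c * g (lam * c) + f (lam * s) * g s = (\<Sum>S\<in>\<Gamma>. f (h S) * g (h S))"
    if "rat_linear f" "rat_linear g" for f g
    by (rule tiling_sum_identity[OF assms(1) fin tile(1-3) _ tile(5), symmetric])
      (simp_all only: tile(4) rat_linear_imp_additive that)
  have "\<exists>P\<in>\<rat>. \<exists>N\<in>\<rat>. N > 0 \<and> lam\<^sup>2 - 2 * P * lam + N = 0"
  proof (rule symmetric_form_imp_quadratic[OF tile(1) assms(1) False, of s])
    fix f g assume fg: "rat_linear f" "rat_linear g"
    \<comment> \<open>Squares have equal width and height, so their additive area is symmetric in
      \<open>f\<close> and \<open>g\<close>, and a sum of squares for \<open>f = g\<close>.\<close>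
    have "(\<Sum>S\<in>\<Gamma>. f (h S) * g (h S)) = (\<Sum>S\<in>\<Gamma>. g (h S) * f (h S))"
      by (simp only: mult.commute)
    then show "f c * g (lam * c) + f (lam * s) * g s = g c * f (lam * c) + g (lam * s) * f s"
      using identity[OF fg] identity[OF fg(2,1)] by simp
  next
    fix f assume "rat_linear f"
    then show "0 \<le> f c * f (lam * c) + f (lam * s) * f s"
      by (simp add: identity sum_nonneg)
  qed
  then show ?thesis by (elim bexE conjE) (rule quadratic_imp_sqrt_form[OF assms(1)])
qed

end
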